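(* Given $\ell$ $u$-sorted arrays $A_1,\ldots,A_\ell$ of total size $n$ and a rank $k$, there is a deterministic algorithm that returns $\ell$ subintervals $B_1,\ldots,B_\ell$ of these arrays ($B_i$ a subinterval of $A_i$) and a number $k'$ such that: (i) the element of rank $k'$ in $B_1\cup\cdots\cup B_\ell$ is the element of rank $k$ in $A_1\cup\cdots\cup A_\ell$; (ii) the running time is $O(\ell\log(n/\ell))$; (iii) $\sum_{i=1}^\ell |B_i| = O(\ell\cdot n/u)$.
   Context: An array $X$ (of distinct elements from a totally ordered set) is $u$-sorted if there is a sorted list $L(X)$ of at most $20u$ elements of $X$ that appear in this sorted order in $X$ (not necessarily consecutively), such that for every $\alpha\in L(X)$ all elements of $X$ smaller than $\alpha$ appear before $\alpha$ in $X$ and all elements larger than $\alpha$ appear after $\alpha$, and the distance in $X$ between any two consecutive elements of $L(X)$ is at most $|X|/u$. The element of rank $r$ of a set is its $r$-th smallest element.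
   Formalization: The ends of an array count as consecutive to the first and last element of L(X) (otherwise an empty L makes every array u-sorted and the claim fails); the arrays are assumed pairwise disjoint; 1 ≤ u ≤ n; log(n/ℓ) is read as at least 1. *)

theory Defs
  imports Complex_Main
begin

section \<open>u-sorted arrays, ranks, subintervals\<close>

text \<open>Arrays are lists, indexed from 0.  The list \<open>L\<close> is given by the increasing list \<open>ps\<close>
of the positions of its elements.  In the bound on the distances the two ends of the array count
as list elements, so that the stretches before the first and after the last element
of \<open>L\<close> are bounded as well; otherwise every array would be u-sorted (take \<open>L\<close> empty).\<close>

definition u_sorted :: "nat \<Rightarrow> 'a::linorder list \<Rightarrow> bool" where
  "u_sorted u X \<longleftrightarrow> distinct X \<and>
     (\<exists>L ps. sorted_wrt (<) ps \<and> (\<forall>p\<in>set ps. p < length X) \<and> L = map (\<lambda>p. X ! p) ps \<and>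
        sorted L \<and> length L \<le> 20 * u \<and>
        (\<forall>p\<in>set ps. \<forall>q<length X.
           (X ! q < X ! p \<longrightarrow> q < p) \<and> (X ! p < X ! q \<longrightarrow> p < q)) \<and>
        (let qs = 0 # ps @ [length X - 1] in
           \<forall>j. Suc j < length qs \<longrightarrow>
             real (qs ! Suc j) - real (qs ! j) \<le> real (length X) / real u))"

text \<open>Ranks start at 1; meaningful for finite \<open>S\<close> and \<open>1 \<le> r \<le> card S\<close>.\<close>

definition elem_of_rank :: "nat \<Rightarrow> 'a::linorder set \<Rightarrow> 'a" where
  "elem_of_rank r S = sorted_list_of_set S ! (r - 1)"

definition subinterval :: "nat \<Rightarrow> nat \<Rightarrow> 'a list \<Rightarrow> 'a list" where
  "subinterval lo hi X = take (hi - lo) (drop lo X)"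

section \<open>Comparison-based word RAM\<close>

text \<open>Programs are finite syntactic objects in an imperative language over \<open>w\<close>-bit words.
They own finitely many variables and finitely many memory arrays (both named by
numerals fixed in the program text) and may use recursive procedures.  The input arrays are
read-only; a program learns about them only through their lengths and through comparisons of two
of their elements.  Every operation has unit cost; in particular the
continuations of a program cannot perform uncharged computations, since there is no embedding of
HOL functions into programs.\<close>

datatype expr =
    Num nat
  | Var nat
  | Get nat expr            \<comment> \<open>cell of the memory array with the given name\<close>
  | Len expr                \<comment> \<open>length of the input array with the given index\<close>
  | Add expr expr
  | Sub expr expr
  | Mul expr expr
  | Div expr expr

datatype cond =
    Less expr expr
  | Elem_Less expr expr expr expr   \<comment> \<open>\<open>Elem_Less i p j q\<close> tests \<open>A\<^sub>i[p] < A\<^sub>j[q]\<close>\<close>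
  | Not cond
  | And cond cond

datatype com =
    Skip
  | Assign nat expr
  | Put nat expr expr       \<comment> \<open>memory array name, cell index, new value\<close>
  | Seq com com
  | If cond com com
  | While cond com
  | Call nat nat "expr list"  \<comment> \<open>result variable, procedure index, arguments\<close>

text \<open>A program consists of its procedure bodies and its main command.\<close>

type_synonym program = "com list \<times> com"

type_synonym vars = "nat \<Rightarrow> nat"
type_synonym memory = "nat \<Rightarrow> nat \<Rightarrow> nat"

text \<open>Sums, products and constants are reduced modulo \<open>2 ^ w\<close>.  Subtraction is truncated at 0
and division is the one of \<^typ>\<open>nat\<close> (with \<open>x div 0 = 0\<close>).  Accesses outside the
input yield length 0, respectively a false comparison.\<close>

fun eval :: "nat \<Rightarrow> 'a list list \<Rightarrow> vars \<Rightarrow> memory \<Rightarrow> expr \<Rightarrow> nat" where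
  "eval w A v m (Num c) = c mod 2 ^ w"
| "eval w A v m (Var x) = v x"
| "eval w A v m (Get a e) = m a (eval w A v m e)"
| "eval w A v m (Len e) =
     (let i = eval w A v m e in if i < length A then length (A ! i) else 0)"
| "eval w A v m (Add e f) = (eval w A v m e + eval w A v m f) mod 2 ^ w"
| "eval w A v m (Sub e f) = eval w A v m e - eval w A v m f"
| "eval w A v m (Mul e f) = (eval w A v m e * eval w A v m f) mod 2 ^ w"
| "eval w A v m (Div e f) = eval w A v m e div eval w A v m f"

fun test :: "nat \<Rightarrow> 'a::linorder list list \<Rightarrow> vars \<Rightarrow> memory \<Rightarrow> cond \<Rightarrow> bool" where
  "test w A v m (Less e f) = (eval w A v m e < eval w A v m f)"
| "test w A v m (Elem_Less e p f q) =
     (let i = eval w A v m e; s = eval w A v m p; j = eval w A v m f; t = eval w A v m q in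
        i < length A \<and> s < length (A ! i) \<and> j < length A \<and> t < length (A ! j) \<and>
        A ! i ! s < A ! j ! t)"
| "test w A v m (Not b) = (\<not> test w A v m b)"
| "test w A v m (And b c) = (test w A v m b \<and> test w A v m c)"

fun expr_cost :: "expr \<Rightarrow> nat" where
  "expr_cost (Num c) = 1"
| "expr_cost (Var x) = 1"
| "expr_cost (Get a e) = 1 + expr_cost e"
| "expr_cost (Len e) = 1 + expr_cost e"
| "expr_cost (Add e f) = 1 + expr_cost e + expr_cost f"
| "expr_cost (Sub e f) = 1 + expr_cost e + expr_cost f"
| "expr_cost (Mul e f) = 1 + expr_cost e + expr_cost f"
| "expr_cost (Div e f) = 1 + expr_cost e + expr_cost f"

fun cond_cost :: "cond \<Rightarrow> nat" where
  "cond_cost (Less e f) = 1 + expr_cost e + expr_cost f"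
| "cond_cost (Elem_Less e p f q) =
     1 + expr_cost e + expr_cost p + expr_cost f + expr_cost q"
| "cond_cost (Not b) = 1 + cond_cost b"
| "cond_cost (And b c) = 1 + cond_cost b + cond_cost c"

text \<open>\<open>exec w A P c v m t v' m'\<close>: with procedures \<open>P\<close>, input arrays \<open>A\<close> and word size \<open>w\<close>,
command \<open>c\<close> started in variables \<open>v\<close> and memory \<open>m\<close> halts after \<open>t\<close> steps in \<open>v'\<close>, \<open>m'\<close>.
A procedure has its own variables, the first of which are the arguments, and shares the memory;
its result is its final variable 0.\<close>

inductive exec ::
  "nat \<Rightarrow> 'a::linorder list list \<Rightarrow> com list \<Rightarrow> com \<Rightarrow> vars \<Rightarrow> memory \<Rightarrow>
   nat \<Rightarrow> vars \<Rightarrow> memory \<Rightarrow> bool"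
  for w :: nat and A :: "'a list list" and P :: "com list" where
  Skip: "exec w A P Skip v m 1 v m"
| Assign: "exec w A P (Assign x e) v m (1 + expr_cost e) (v(x := eval w A v m e)) m"
| Put: "exec w A P (Put a e f) v m (1 + expr_cost e + expr_cost f)
          v (m(a := (m a)(eval w A v m e := eval w A v m f)))"
| Seq: "exec w A P c v m s v' m' \<Longrightarrow> exec w A P d v' m' t v'' m'' \<Longrightarrow>
          exec w A P (Seq c d) v m (1 + s + t) v'' m''"
| IfTrue: "test w A v m b \<Longrightarrow> exec w A P c v m t v' m' \<Longrightarrow>
          exec w A P (If b c d) v m (1 + cond_cost b + t) v' m'"
| IfFalse: "\<not> test w A v m b \<Longrightarrow> exec w A P d v m t v' m' \<Longrightarrow>
          exec w A P (If b c d) v m (1 + cond_cost b + t) v' m'"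
| WhileFalse: "\<not> test w A v m b \<Longrightarrow>
          exec w A P (While b c) v m (1 + cond_cost b) v m"
| WhileTrue: "test w A v m b \<Longrightarrow> exec w A P c v m s v' m' \<Longrightarrow>
          exec w A P (While b c) v' m' t v'' m'' \<Longrightarrow>
          exec w A P (While b c) v m (1 + cond_cost b + s + t) v'' m''"
| Call: "f < length P \<Longrightarrow>
          exec w A P (P ! f)
            (\<lambda>i. if i < length es then eval w A v m (es ! i) else 0) m t v' m' \<Longrightarrow>
          exec w A P (Call x f es) v m (1 + sum_list (map expr_cost es) + t)
            (v(x := v' 0)) m'"

lemma exec_deterministic:
  assumes "exec w A P c v m t v' m'" and "exec w A P c v m s v'' m''"
  shows "s = t \<and> v'' = v' \<and> m'' = m'"
  using assms
proof (induction arbitrary: s v'' m'' rule: exec.induct)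
  case Skip then show ?case by (auto elim: exec.cases)
next
  case Assign then show ?case by (auto elim: exec.cases)
next
  case Put then show ?case by (auto elim: exec.cases)
next
  case (Seq c v m s1 v1 m1 d t1 v2 m2)
  from Seq.prems show ?case by cases (use Seq.IH in blast)+
next
  case (IfTrue v m b c t v' m' d)
  from IfTrue.prems show ?case by cases (use IfTrue in blast)+
next
  case (IfFalse v m b d t v' m' c)
  from IfFalse.prems show ?case by cases (use IfFalse in blast)+
next
  case (WhileFalse v m b c)
  from WhileFalse.prems show ?case by cases (use WhileFalse.hyps in blast)+
next
  case (WhileTrue v m b c s1 v1 m1 t1 v2 m2)
  from WhileTrue.prems show ?case by cases (use WhileTrue in blast)+
next
  case (Call f es v m t v' m' x)
  from Call.prems show ?case by cases (use Call.IH in blast)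
qed

text \<open>The program starts with the number of arrays, \<open>u\<close> and \<open>k\<close> in variables 0, 1, 2 and with
all other variables and all memory equal to 0.  It halts after \<open>t\<close> steps with \<open>k'\<close> in
variable 0 and with the boundaries of the \<open>i\<close>-th subinterval
(first position, and one past the last position) in cell \<open>i\<close> of the memory arrays 0 and 1.\<close>

definition runs_to ::
  "program \<Rightarrow> nat \<Rightarrow> 'a::linorder list list \<Rightarrow> nat \<Rightarrow> nat \<Rightarrow>
   nat \<Rightarrow> (nat \<Rightarrow> nat) \<Rightarrow> (nat \<Rightarrow> nat) \<Rightarrow> nat \<Rightarrow> bool" where
  "runs_to prog w A u k t lo hi k' \<longleftrightarrow>
     (\<exists>v m. exec w A (fst prog) (snd prog)
              ((\<lambda>_. 0)(0 := length A, 1 := u, 2 := k)) (\<lambda>_ _. 0) t v m \<and>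
            v 0 = k' \<and> m 0 = lo \<and> m 1 = hi)"

end

theory Submission
  imports Defs
begin

text \<open>All that is used of u-sortedness is that \<open>X ! p < X ! q\<close> whenever \<open>q - p\<close> exceeds
\<open>g = n div u\<close>: then some element of the unknown list \<open>L\<close> lies between the two positions.

The algorithm keeps in every array a window outside of which all elements are known to be smaller,
respectively larger, than the element sought.  Let \<open>N\<close> be the total size of the \<open>l\<close> windows.  As long
as \<open>N > 64 * l * (g + 1)\<close>, put \<open>s = N div (64 * l)\<close>.  Then \<open>s > g\<close>, so the elements at distance \<open>s\<close> of a
window are sorted.  These \<open>O(l)\<close> samples are merged in a binary tree, and every second level of the
tree keeps only every second element of a list.  This takes time \<open>O(l)\<close>, and the rank of an element of the
final list determines its rank among all elements of the windows up to an error of \<open>O(s * l)\<close>, which is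
a small fraction of \<open>N\<close>.  A pivot of approximate rank \<open>N / 4\<close> or \<open>3 * N / 4\<close>, depending on the half that
contains the element sought, removes at least a sixteenth of the elements.  Hence there are
\<open>O(log (n / l))\<close> rounds.\<close>

section \<open>Total correctness with running time\<close>

text \<open>A round may take only O(l) steps, so the O(l) samples cannot simply be sorted: that
  would cost a further factor log l. Merging with thinning replaces sorting and yields approximate
  ranks, which suffices because a round only has to discard a constant fraction of the elements. A
  window is itself unsorted at distances below \<open>s\<close>, so a pivot cannot split it exactly:
  a cut may leave up to \<open>3 * s\<close> elements of each window on the wrong side. With 64 in
  the definition of \<open>s\<close>, the unit \<open>E = s * l\<close> of all these errors is at
  most \<open>N / 64\<close>, and the quarter of the elements beyond the pivot outweighs their sum.
  Cutting proceeds in strides of \<open>s\<close> and so takes O(N / s) = O(l) steps; as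
  \<open>s\<close> shrinks together with \<open>N\<close>, late rounds cost no more than early
  ones.\<close>

definition wp :: "nat \<Rightarrow> 'a::linorder list list \<Rightarrow> com list \<Rightarrow> com \<Rightarrow>
    (nat \<Rightarrow> vars \<Rightarrow> memory \<Rightarrow> bool) \<Rightarrow> vars \<Rightarrow> memory \<Rightarrow> bool" where
  "wp w A P c Q v m \<longleftrightarrow> (\<exists>t v' m'. exec w A P c v m t v' m' \<and> Q t v' m')"

lemma wpI: "exec w A P c v m t v' m' \<Longrightarrow> Q t v' m' \<Longrightarrow> wp w A P c Q v m"
  unfolding wp_def by blast

lemma wpE:
  assumes "wp w A P c Q v m"
  obtains t v' m' where "exec w A P c v m t v' m'" "Q t v' m'"
  using assms unfolding wp_def by blast

lemma wp_mono:
  "wp w A P c Q v m \<Longrightarrow> (\<And>t v' m'. Q t v' m' \<Longrightarrow> R t v' m') \<Longrightarrow> wp w A P c R v m"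
  unfolding wp_def by blast

lemma wp_Assign [simp]:
  "wp w A P (Assign x e) Q v m \<longleftrightarrow> Q (1 + expr_cost e) (v(x := eval w A v m e)) m"
  by (auto elim!: wpE elim: exec.cases simp del: plus_1_eq_Suc intro!: wpI[OF exec.Assign])

lemma wp_Put [simp]:
  "wp w A P (Put a e f) Q v m \<longleftrightarrow> Q (1 + expr_cost e + expr_cost f) v
     (m(a := (m a)(eval w A v m e := eval w A v m f)))"
  by (auto elim!: wpE elim: exec.cases simp del: plus_1_eq_Suc intro!: wpI[OF exec.Put])

lemma wp_Seq [simp]:
  "wp w A P (Seq c d) Q v m \<longleftrightarrow>
     wp w A P c (\<lambda>s. wp w A P d (\<lambda>t. Q (1 + s + t))) v m" (is "?L \<longleftrightarrow> ?R")
proof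
  assume ?L
  then obtain t v' m' where "exec w A P (Seq c d) v m t v' m'" "Q t v' m'" by (rule wpE)
  then show ?R by cases (blast intro: wpI)
qed (blast elim: wpE intro: wpI exec.Seq)

lemma wp_If [simp]:
  "wp w A P (If b c d) Q v m \<longleftrightarrow>
     (if test w A v m b then wp w A P c (\<lambda>t. Q (1 + cond_cost b + t)) v m
      else wp w A P d (\<lambda>t. Q (1 + cond_cost b + t)) v m)" (is "?L \<longleftrightarrow> ?R")
proof
  assume ?L
  then obtain t v' m' where "exec w A P (If b c d) v m t v' m'" "Q t v' m'" by (rule wpE)
  then show ?R
    by cases (simp_all only: if_True if_False, (blast intro: wpI)+)
qed (auto elim!: wpE simp del: plus_1_eq_Suc split: if_splits
    intro: wpI[OF exec.IfTrue] wpI[OF exec.IfFalse])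

text \<open>Procedure specifications start from such a state. Its zeros matter: \<open>Var 7\<close>
  and \<open>Var 8\<close> in \<open>merge_proc\<close>, and \<open>Var 3\<close> and
  \<open>Var 4\<close> in the cutting procedures, are counters that the code does not
  initialise.\<close>

definition frame :: "nat list \<Rightarrow> vars" where
  "frame es = (\<lambda>i. if i < length es then es ! i else 0)"

lemma wp_Call [simp]:
  "wp w A P (Call x f es) Q v m \<longleftrightarrow> f < length P \<and>
     wp w A P (P ! f) (\<lambda>t v' m'. Q (1 + sum_list (map expr_cost es) + t) (v(x := v' 0)) m')
       (frame (map (eval w A v m) es)) m"
proof -
  have fr: "frame (map (eval w A v m) es) =
      (\<lambda>i. if i < length es then eval w A v m (es ! i) else 0)"
    by (auto simp: frame_def)
  show ?thesis (is "?L \<longleftrightarrow> ?R")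
    unfolding fr
  proof
    assume ?L
    then obtain t v' m' where "exec w A P (Call x f es) v m t v' m'" "Q t v' m'" by (rule wpE)
    then show "f < length P \<and>
      wp w A P (P ! f) (\<lambda>t v' m'. Q (1 + sum_list (map expr_cost es) + t) (v(x := v' 0)) m')
        (\<lambda>i. if i < length es then eval w A v m (es ! i) else 0) m"
      by cases (blast intro: wpI)
  qed (blast elim: wpE intro: wpI exec.Call)
qed

text \<open>The ghost parameter \<open>\<tau>\<close> of the invariant bounds the time that the loop may still use;
since every test costs at least one step, the bound also yields termination.\<close>

lemma wp_While:
  fixes I :: "nat \<Rightarrow> vars \<Rightarrow> memory \<Rightarrow> bool"
  assumes "I \<tau> v m"
    and step: "\<And>\<tau> v m. I \<tau> v m \<Longrightarrow> test w A v m b \<Longrightarrow>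
      wp w A P c (\<lambda>s v' m'. \<exists>\<tau>'. I \<tau>' v' m' \<and> 1 + cond_cost b + s + \<tau>' \<le> \<tau>) v m"
    and exit: "\<And>\<tau> v m. I \<tau> v m \<Longrightarrow> \<not> test w A v m b \<Longrightarrow> 1 + cond_cost b \<le> \<tau>"
  shows "wp w A P (While b c)
    (\<lambda>t v' m'. t \<le> \<tau> \<and> \<not> test w A v' m' b \<and> (\<exists>\<tau>'. I \<tau>' v' m')) v m"
  using assms(1)
proof (induction \<tau> arbitrary: v m rule: less_induct)
  case (less \<tau>)
  show ?case
  proof (cases "test w A v m b")
    case True
    from step[OF less.prems True] obtain s v' m' \<tau>' where
      1: "exec w A P c v m s v' m'" "I \<tau>' v' m'" "1 + cond_cost b + s + \<tau>' \<le> \<tau>"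
      by (auto simp: wp_def)
    then obtain t v'' m'' \<tau>'' where
      2: "exec w A P (While b c) v' m' t v'' m''" "t \<le> \<tau>'" "\<not> test w A v'' m'' b"
        "I \<tau>'' v'' m''"
      using less.IH[of \<tau>' v' m'] by (auto simp: wp_def)
    show ?thesis
      using exec.WhileTrue[OF True 1(1) 2(1)] 1(3) 2(2-4) by (fastforce simp: wp_def)
  next
    case False
    then show ?thesis
      using exit[OF less.prems False] exec.WhileFalse[OF False] less.prems
      by (fastforce simp: wp_def)
  qed
qed

section \<open>Merging and thinning sorted lists\<close>

text \<open>Keys are compared through \<open>val\<close>.  Counts of small elements are taken with respect to a
downward closed predicate \<open>D\<close>: the constantly true one yields lengths.\<close>

context
  fixes val :: "nat \<Rightarrow> 'a::linorder"
begin

definition ssorted :: "nat list \<Rightarrow> bool" where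
  "ssorted L \<longleftrightarrow> sorted_wrt (\<lambda>a b. val a < val b) L"

definition down :: "(nat \<Rightarrow> bool) \<Rightarrow> bool" where
  "down D \<longleftrightarrow> (\<forall>a b. val a < val b \<longrightarrow> D b \<longrightarrow> D a)"

fun mrg :: "nat list \<Rightarrow> nat list \<Rightarrow> nat list" where
  "mrg [] ys = ys"
| "mrg (x # xs) [] = x # xs"
| "mrg (x # xs) (y # ys) =
     (if val x < val y then x # mrg xs (y # ys) else y # mrg (x # xs) ys)"

lemma mrg_Nil2 [simp]: "mrg xs [] = xs"
  by (cases xs) auto

lemma set_mrg [simp]: "set (mrg xs ys) = set xs \<union> set ys"
  by (induction xs ys rule: mrg.induct) auto

lemma length_mrg [simp]: "length (mrg xs ys) = length xs + length ys"
  by (induction xs ys rule: mrg.induct) auto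

lemma ssorted_mrg:
  assumes "ssorted xs" "ssorted ys" "\<And>x y. x \<in> set xs \<Longrightarrow> y \<in> set ys \<Longrightarrow> val x \<noteq> val y"
  shows "ssorted (mrg xs ys)"
  using assms
proof (induction xs ys rule: mrg.induct)
  case (3 x xs y ys)
  show ?case
  proof (cases "val x < val y")
    case True
    have "ssorted (mrg xs (y # ys))"
      using 3(3-5) by (intro 3(1)[OF True]) (auto simp: ssorted_def)
    moreover have "\<forall>z\<in>set xs \<union> set (y # ys). val x < val z"
      using 3(3,4) True by (auto simp: ssorted_def intro: less_trans)
    ultimately show ?thesis using True by (simp add: ssorted_def)
  next
    case False
    then have lt: "val y < val x" using 3(5)[of x y] by auto
    have "ssorted (mrg (x # xs) ys)"
      using 3(3-5) by (intro 3(2)[OF False]) (auto simp: ssorted_def)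
    moreover have "\<forall>z\<in>set (x # xs) \<union> set ys. val y < val z"
      using 3(3,4) lt by (auto simp: ssorted_def intro: less_trans)
    ultimately show ?thesis using False by (simp add: ssorted_def)
  qed
qed auto

definition cnt :: "(nat \<Rightarrow> bool) \<Rightarrow> nat list \<Rightarrow> nat" where
  "cnt D L = length (filter D L)"

lemma cnt_True [simp]: "cnt (\<lambda>_. True) L = length L"
  by (simp add: cnt_def)

lemma cnt_le_length: "cnt D L \<le> length L"
  by (simp add: cnt_def)

lemma cnt_mrg [simp]: "cnt D (mrg xs ys) = cnt D xs + cnt D ys"
  by (induction xs ys rule: mrg.induct) (auto simp: cnt_def)

text \<open>In a sorted list the elements satisfying a downward closed predicate form a prefix, so
  their number is the index at which the prefix ends. Counting thereby becomes comparing
  indices.\<close>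

lemma ssorted_cnt_iff:
  assumes "ssorted L" "down D" "i < length L"
  shows "D (L ! i) \<longleftrightarrow> i < cnt D L"
  using assms
proof (induction L arbitrary: i)
  case (Cons x L)
  show ?case
  proof (cases "D x")
    case True
    with Cons show ?thesis by (cases i) (auto simp: cnt_def ssorted_def)
  next
    case False
    have *: "\<not> D y" if "y \<in> set (x # L)" for y
      using that False Cons.prems by (auto simp: ssorted_def down_def)
    then have "cnt D (x # L) = 0" by (auto simp: cnt_def filter_empty_conv)
    with * show ?thesis using nth_mem[OF Cons.prems(3)] by auto
  qed
qed auto

lemma cnt_eq_index:
  assumes "ssorted L" "r < length L"
  shows "cnt (\<lambda>c. val c < val (L ! r)) L = r"
proof -
  have "val (L ! i) < val (L ! r) \<longleftrightarrow> i < r" if "i < length L" for i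
  proof (cases i r rule: linorder_cases)
    case less
    then show ?thesis using assms by (auto simp: ssorted_def sorted_wrt_iff_nth_less)
  next
    case greater
    then have "val (L ! r) < val (L ! i)"
      using assms that by (auto simp: ssorted_def sorted_wrt_iff_nth_less)
    with greater show ?thesis by auto
  qed auto
  moreover have "down (\<lambda>c. val c < val (L ! r))" by (auto simp: down_def)
  ultimately have *: "i < cnt (\<lambda>c. val c < val (L ! r)) L \<longleftrightarrow> i < r" if "i < length L" for i
    using ssorted_cnt_iff[OF assms(1)] that by blast
  define c where "c = cnt (\<lambda>c. val c < val (L ! r)) L"
  have "\<not> r < c" "\<not> c < r" using *[of r, folded c_def] *[of c, folded c_def] assms(2) by auto
  then show ?thesis by (simp add: c_def)
qed

text \<open>The last element of every complete block of length \<open>d\<close> survives. Choosing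
  the last one rounds counts down, so that all thinning errors have the same sign;
  \<open>d = 1\<close> changes nothing.\<close>

definition dec :: "nat \<Rightarrow> nat list \<Rightarrow> nat list" where
  "dec d L = map (\<lambda>x. L ! (x * d + d - 1)) [0..<length L div d]"

lemma length_dec [simp]: "length (dec d L) = length L div d"
  by (simp add: dec_def)

lemma dec_index: "d \<ge> 1 \<Longrightarrow> x < N div d \<Longrightarrow> x * d + d - 1 < (N::nat)"
proof -
  assume "d \<ge> 1" "x < N div d"
  then have "Suc x * d \<le> N div d * d" by (intro mult_le_mono1) simp
  also have "\<dots> \<le> N" by simp
  finally have "Suc x * d \<le> N" .
  with \<open>d \<ge> 1\<close> show ?thesis by simp
qed

lemma set_dec: "d \<ge> 1 \<Longrightarrow> set (dec d L) \<subseteq> set L"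
  using dec_index[of d] by (auto simp: dec_def)

lemma ssorted_dec:
  assumes "ssorted L" "d \<ge> 1" shows "ssorted (dec d L)"
  unfolding ssorted_def sorted_wrt_iff_nth_less
proof (intro allI impI)
  fix i j assume ij: "i < j" "j < length (dec d L)"
  have "Suc i * d \<le> j * d" using ij(1) by (intro mult_le_mono1) simp
  then have "i * d + d - 1 < j * d + d - 1" using assms(2) by simp
  moreover have "j * d + d - 1 < length L" using dec_index[OF assms(2)] ij(2) by simp
  ultimately show "val (dec d L ! i) < val (dec d L ! j)"
    using assms(1) ij by (auto simp: dec_def ssorted_def sorted_wrt_iff_nth_less)
qed

text \<open>The last element of a block satisfies \<open>D\<close> iff the whole block does, so the
  survivors in \<open>D\<close> correspond to the blocks that lie entirely in the prefix given by
  \<open>D\<close>.\<close>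

lemma cnt_dec:
  assumes "ssorted L" "down D" "d \<ge> 1"
  shows "cnt D (dec d L) = cnt D L div d"
proof -
  have "D (dec d L ! x) \<longleftrightarrow> x < cnt D L div d" if "x < length L div d" for x
  proof -
    have "D (dec d L ! x) \<longleftrightarrow> x * d + d - 1 < cnt D L"
      using ssorted_cnt_iff[OF assms(1,2) dec_index[OF assms(3) that]] that
      by (simp add: dec_def)
    also have "\<dots> \<longleftrightarrow> Suc x * d \<le> cnt D L" using assms(3) by auto
    also have "\<dots> \<longleftrightarrow> x < cnt D L div d"
      using assms(3) by (simp add: less_eq_div_iff_mult_less_eq flip: Suc_le_eq)
    finally show ?thesis .
  qed
  then have "{x. x < length L div d \<and> D (dec d L ! x)} = {x. x < length L div d \<and> x < cnt D L div d}"
    by auto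
  also have "\<dots> = {..<cnt D L div d}"
    using div_le_mono[OF cnt_le_length, of D L d] by auto
  finally show ?thesis
    unfolding cnt_def[of D "dec d L"] length_filter_conv_card by simp
qed

section \<open>The summary tree\<close>

text \<open>Thinning only at every second level halves the lists once while their number shrinks by a
factor of four.  This is what makes the total work linear, and also the accumulated error.\<close>

fun summ :: "(nat \<Rightarrow> nat list) \<Rightarrow> nat \<Rightarrow> nat \<Rightarrow> nat list" where
  "summ f 0 a = f a"
| "summ f (Suc j) a =
     dec (if even (Suc j) then 2 else 1) (mrg (summ f j (2 * a)) (summ f j (2 * a + 1)))"

text \<open>The leaves below node \<open>a\<close> at height \<open>j\<close>, the children of
  \<open>a\<close> being \<open>2 * a\<close> and \<open>2 * a + 1\<close>. The tree exists only
  through this numbering and is never stored.\<close>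

definition leaves :: "nat \<Rightarrow> nat \<Rightarrow> nat set" where
  "leaves j a = {a * 2 ^ j..<(a + 1) * 2 ^ j}"

lemma leaves_0 [simp]: "leaves 0 a = {a}"
  by (auto simp: leaves_def)

lemma leaves_Suc: "leaves (Suc j) a = leaves j (2 * a) \<union> leaves j (2 * a + 1)"
  and leaves_disjoint [simp]: "leaves j (2 * a) \<inter> leaves j (Suc (2 * a)) = {}"
  by (auto simp: leaves_def algebra_simps)

lemma leaves_neq: "b \<in> leaves j (2 * a) \<Longrightarrow> c \<in> leaves j (2 * a + 1) \<Longrightarrow> b \<noteq> c"
  by (metis IntI Suc_eq_plus1 empty_iff leaves_disjoint)

lemma finite_leaves [simp]: "finite (leaves j a)"
  by (simp add: leaves_def)

lemma summ_props:
  assumes "\<And>b. ssorted (f b)"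
    and "\<And>b c x y. b \<noteq> c \<Longrightarrow> x \<in> set (f b) \<Longrightarrow> y \<in> set (f c) \<Longrightarrow> val x \<noteq> val y"
  shows "ssorted (summ f j a) \<and> set (summ f j a) \<subseteq> (\<Union>b\<in>leaves j a. set (f b))"
proof (induction j arbitrary: a)
  case (Suc j)
  let ?m = "mrg (summ f j (2 * a)) (summ f j (2 * a + 1))"
  have sub: "set ?m \<subseteq> (\<Union>b\<in>leaves (Suc j) a. set (f b))"
    using Suc[of "2 * a"] Suc[of "2 * a + 1"] by (auto simp: leaves_Suc)
  have "ssorted ?m"
  proof (rule ssorted_mrg)
    fix x y assume "x \<in> set (summ f j (2 * a))" "y \<in> set (summ f j (2 * a + 1))"
    then have "\<exists>b c. b \<in> leaves j (2 * a) \<and> c \<in> leaves j (2 * a + 1) \<and>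
      x \<in> set (f b) \<and> y \<in> set (f c)"
      using Suc by blast
    then show "val x \<noteq> val y" using assms(2) leaves_neq by metis
  qed (use Suc in auto)
  moreover have "set (summ f (Suc j) a) \<subseteq> set ?m"
    unfolding summ.simps by (rule set_dec) auto
  moreover have "ssorted (summ f (Suc j) a)"
    unfolding summ.simps by (rule ssorted_dec[OF \<open>ssorted ?m\<close>]) auto
  ultimately show ?case using sub by blast
qed (use assms in auto)

text \<open>An element at height \<open>j\<close> stands for \<open>2 ^ (j div 2)\<close> leaf
  elements. Only thinning rounds, and always down, so the first bound has no error term. The deficit
  doubles when two subtrees meet and a thinning adds at most one old weight; the slack of one or two
  weights in the second bound absorbs this and lets the induction go through.\<close>

lemma summ_cnt:
  assumes "\<And>b. ssorted (f b)"
    and "\<And>b c x y. b \<noteq> c \<Longrightarrow> x \<in> set (f b) \<Longrightarrow> y \<in> set (f c) \<Longrightarrow> val x \<noteq> val y"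
    and "down D"
  shows "2 ^ (j div 2) * cnt D (summ f j a) \<le> (\<Sum>b\<in>leaves j a. cnt D (f b)) \<and>
    (\<Sum>b\<in>leaves j a. cnt D (f b)) + (if even j then 1 else 2) * 2 ^ (j div 2)
      \<le> 2 ^ (j div 2) * cnt D (summ f j a) + 2 ^ j"
proof (induction j arbitrary: a)
  case (Suc j)
  let ?m = "mrg (summ f j (2 * a)) (summ f j (2 * a + 1))"
  have sum: "(\<Sum>b\<in>leaves (Suc j) a. cnt D (f b)) =
    (\<Sum>b\<in>leaves j (2 * a). cnt D (f b)) + (\<Sum>b\<in>leaves j (2 * a + 1). cnt D (f b))"
    unfolding leaves_Suc by (rule sum.union_disjoint) auto
  have props: "ssorted (summ f j b)" "set (summ f j b) \<subseteq> (\<Union>c\<in>leaves j b. set (f c))" for b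
    using summ_props[of f j b] assms(1,2) by blast+
  have sorted: "ssorted ?m"
  proof (rule ssorted_mrg)
    fix x y assume "x \<in> set (summ f j (2 * a))" "y \<in> set (summ f j (2 * a + 1))"
    then have "\<exists>b c. b \<in> leaves j (2 * a) \<and> c \<in> leaves j (2 * a + 1) \<and>
      x \<in> set (f b) \<and> y \<in> set (f c)"
      using props by blast
    then show "val x \<noteq> val y" using assms(2) leaves_neq by metis
  qed (use props in auto)
  define c1 where "c1 = cnt D (summ f j (2 * a))"
  define c2 where "c2 = cnt D (summ f j (2 * a + 1))"
  define W :: nat where "W = 2 ^ (j div 2)"
  define S1 where "S1 = (\<Sum>b\<in>leaves j (2 * a). cnt D (f b))"
  define S2 where "S2 = (\<Sum>b\<in>leaves j (2 * a + 1). cnt D (f b))"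
  define q :: nat where "q = (if even j then 1 else 2) * W"
  have IH: "W * c1 \<le> S1" "S1 + q \<le> W * c1 + 2 ^ j" "W * c2 \<le> S2" "S2 + q \<le> W * c2 + 2 ^ j"
    using Suc[of "2 * a"] Suc[of "2 * a + 1"]
    unfolding c1_def c2_def W_def S1_def S2_def q_def by blast+
  note sum = sum[folded S1_def S2_def]
  show ?case
  proof (cases "even j")
    case True
    have c: "cnt D (summ f (Suc j) a) = c1 + c2"
      using cnt_dec[OF sorted assms(3), of 1] True by (simp add: c1_def c2_def)
    have W: "2 ^ (Suc j div 2) = W" "q = W" using True by (auto simp: W_def q_def)
    have "W * (c1 + c2) \<le> S1 + S2" "S1 + S2 + 2 * W \<le> W * (c1 + c2) + 2 * 2 ^ j"
      using IH W(2) unfolding distrib_left by linarith+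
    then show ?thesis unfolding sum c W(1) using True by simp
  next
    case False
    have c: "cnt D (summ f (Suc j) a) = (c1 + c2) div 2"
      using cnt_dec[OF sorted assms(3), of 2] False by (simp add: c1_def c2_def)
    have W: "2 ^ (Suc j div 2) = 2 * W" "q = 2 * W" using False by (auto simp: W_def q_def)
    \<comment> \<open>Halving loses at most one element of weight \<open>W\<close>. The two subtrees
      bring slack \<open>2 * q = 4 * W\<close>, of which only \<open>2 * W\<close> is needed at the
      new height.\<close>
    have "2 * ((c1 + c2) div 2) \<le> c1 + c2" "c1 + c2 \<le> 2 * ((c1 + c2) div 2) + 1" by auto
    from mult_le_mono2[OF this(1), of W] mult_le_mono2[OF this(2), of W]
    have "2 * W * ((c1 + c2) div 2) \<le> W * c1 + W * c2"
      "W * c1 + W * c2 \<le> 2 * W * ((c1 + c2) div 2) + W"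
      by (simp_all add: algebra_simps)
    then have "2 * W * ((c1 + c2) div 2) \<le> S1 + S2"
      "S1 + S2 + 2 * W \<le> 2 * W * ((c1 + c2) div 2) + 2 * 2 ^ j"
      using IH W(2) by linarith+
    then show ?thesis unfolding sum c W(1) using False by simp
  qed
qed auto

text \<open>A time bound shaped like the recursion of \<open>summ\<close>, so that it can be
  verified against the program call by call; its closed form is then pure arithmetic.\<close>

fun scost :: "(nat \<Rightarrow> nat list) \<Rightarrow> nat \<Rightarrow> nat \<Rightarrow> nat" where
  "scost f 0 a = 50 + 50 * length (f a)"
| "scost f (Suc j) a = 150 + scost f j (2 * a) + scost f j (2 * a + 1)
     + 150 * (length (summ f j (2 * a)) + length (summ f j (2 * a + 1)))"

end

lemma summ_length:
  assumes "\<And>b. ssorted val (f b)"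
    and "\<And>b c x y. b \<noteq> c \<Longrightarrow> x \<in> set (f b) \<Longrightarrow> y \<in> set (f c) \<Longrightarrow> val x \<noteq> val y"
  shows "2 ^ (j div 2) * length (summ val f j a) \<le> (\<Sum>b\<in>leaves j a. length (f b))"
  using summ_cnt[of val f "\<lambda>_. True" j a] assms by (simp add: down_def)

text \<open>At height \<open>j\<close> the lists have together at most
  \<open>S / 2 ^ (j div 2)\<close> elements, where \<open>S\<close> is the number of samples at the
  leaves. Every power of two serves two consecutive heights, so the merging costs form a geometric
  series with sum below \<open>4 * S\<close>. The factor \<open>5 - (4 or 3) / 2 ^ (j div 2)\<close>
  is 1 for the leaves plus the partial sum of this series.\<close>

lemma scost_bound:
  fixes val :: "nat \<Rightarrow> 'a::linorder"
  assumes "\<And>b. ssorted val (f b)"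
    and "\<And>b c x y. b \<noteq> c \<Longrightarrow> x \<in> set (f b) \<Longrightarrow> y \<in> set (f c) \<Longrightarrow> val x \<noteq> val y"
  shows "scost val f j a \<le> 300 * 2 ^ j + 750 * (\<Sum>b\<in>leaves j a. length (f b))"
proof -
  define S where "S j a = real (\<Sum>b\<in>leaves j a. length (f b))" for j a
  have S0: "S j a \<ge> 0" for j a unfolding S_def by (rule of_nat_0_le_iff)
  have "real (scost val f j a) \<le> 300 * 2 ^ j - 150 +
      150 * S j a * (5 - (if even j then 4 else 3) / 2 ^ (j div 2))"
  proof (induction j arbitrary: a)
    case 0
    have "S 0 a = real (length (f a))" by (simp add: S_def)
    then show ?case by simp
  next
    case (Suc j)
    have sum: "S (Suc j) a = S j (2 * a) + S j (2 * a + 1)"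
      unfolding S_def leaves_Suc of_nat_add[symmetric]
      by (subst sum.union_disjoint) auto
    have len: "real (length (summ val f j b)) \<le> S j b / 2 ^ (j div 2)" for b
    proof -
      have "2 ^ (j div 2) * length (summ val f j b) \<le> (\<Sum>b\<in>leaves j b. length (f b))"
        using summ_length[of val f j b] assms by blast
      then have "real (2 ^ (j div 2) * length (summ val f j b)) \<le> S j b"
        unfolding S_def by (rule of_nat_mono)
      then show ?thesis by (simp add: field_simps)
    qed
    define W :: real where "W = 2 ^ (j div 2)"
    have W: "W > 0" by (simp add: W_def)
    define e :: real where "e = (if even j then 4 else 3)"
    have *: "real (scost val f (Suc j) a) \<le> 300 * 2 ^ Suc j - 150
      + 150 * (S j (2 * a) + S j (2 * a + 1)) * (5 - (e - 1) / W)"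
      using Suc[of "2 * a"] Suc[of "2 * a + 1"] len[of "2 * a"] len[of "2 * a + 1"]
      unfolding W_def[symmetric] e_def[symmetric]
      by (simp add: algebra_simps divide_inverse)
    \<comment> \<open>For even \<open>j\<close> the weight stays and 4 - 1 = 3; for odd
      \<open>j\<close> it doubles and \<open>2 / W = 4 / (2 * W)\<close>.\<close>
    have "(e - 1) / W = (if even (Suc j) then 4 else 3) / 2 ^ (Suc j div 2)"
      by (auto simp: e_def W_def)
    with * show ?case by (simp only: sum)
  qed
  also have "\<dots> \<le> 300 * 2 ^ j + 150 * S j a * 5"
    using S0[of j a] by (intro add_mono mult_left_mono) auto
  also have "\<dots> = real (300 * 2 ^ j + 750 * (\<Sum>b\<in>leaves j a. length (f b)))"
    by (simp add: S_def)
  finally show ?thesis by (simp only: of_nat_le_iff)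
qed

section \<open>The program\<close>

text \<open>A position \<open>p\<close> of the \<open>i\<close>-th of \<open>l\<close> arrays is encoded by the single word \<open>p * l + i\<close>.
Memory arrays 0 and 1 hold the boundaries of the current windows, array 2 is a stack of sorted
lists of codes, and array 3 is scratch space for merging.\<close>

definition arr :: "expr \<Rightarrow> expr \<Rightarrow> expr" where
  "arr c l = Sub c (Mul (Div c l) l)"

text \<open>The nested negations say that the left list is nonempty and that the right one is
  exhausted or starts with a larger key. A key comparison beyond the end of a list is masked by the
  index tests.\<close>

definition merge_loop :: com where
  "merge_loop =
    While (Less (Var 7) (Sub (Var 2) (Var 0)))
          (Seq (If (And (Less (Var 5) (Var 1))
                     (Not (And (Less (Var 6) (Var 2))
                       (Not (Elem_Less
                         (arr (Get 2 (Var 5)) (Var 3)) (Div (Get 2 (Var 5)) (Var 3))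
                         (arr (Get 2 (Var 6)) (Var 3)) (Div (Get 2 (Var 6)) (Var 3)))))))
                 (Seq (Put 3 (Var 7) (Get 2 (Var 5))) (Assign 5 (Add (Var 5) (Num 1))))
                 (Seq (Put 3 (Var 7) (Get 2 (Var 6))) (Assign 6 (Add (Var 6) (Num 1)))))
               (Assign 7 (Add (Var 7) (Num 1))))"

definition copy_loop :: com where
  "copy_loop =
    While (Less (Var 8) (Div (Var 7) (Var 4)))
          (Seq (Put 2 (Add (Var 0) (Var 8))
                 (Get 3 (Sub (Add (Mul (Var 8) (Var 4)) (Var 4)) (Num 1))))
               (Assign 8 (Add (Var 8) (Num 1))))"

text \<open>Arguments: the three boundaries of two adjacent lists on the stack, the number of
  arrays, and the thinning factor. The thinned merge overwrites the two lists, and the result is the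
  new stack top.\<close>

definition merge_proc :: com where
  "merge_proc =
    Seq (Assign 5 (Var 0))
   (Seq (Assign 6 (Var 1))
   (Seq merge_loop
   (Seq copy_loop
        (Assign 0 (Add (Var 0) (Var 8))))))"

definition sample_loop :: com where
  "sample_loop =
    While (Less (Var 5) (Get 1 (Var 1)))
            (Seq (Put 2 (Var 2) (Add (Mul (Var 5) (Var 4)) (Var 1)))
            (Seq (Assign 2 (Add (Var 2) (Num 1)))
                 (Assign 5 (Add (Var 5) (Var 3)))))"

text \<open>This is \<open>2 - h mod 2\<close> for the height \<open>h\<close> in
  \<open>Var 0\<close>: factor 2 at even heights, 1 at odd ones.\<close>

definition stride :: expr where
  "stride = Sub (Num 2) (Sub (Var 0) (Mul (Num 2) (Div (Var 0) (Num 2))))"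

text \<open>Arguments: height, node, stack top, sample distance, number of arrays. The result is the
  new stack top, so the right child starts where the left one ended. For leaves beyond the last
  array both window bounds are 0 and nothing is pushed.\<close>

definition summ_proc :: com where
  "summ_proc =
    If (Less (Num 0) (Var 0))
     (Seq (Call 5 1 [Sub (Var 0) (Num 1), Mul (Num 2) (Var 1), Var 2, Var 3, Var 4])
     (Seq (Call 6 1 [Sub (Var 0) (Num 1), Add (Mul (Num 2) (Var 1)) (Num 1), Var 5, Var 3, Var 4])
          (Call 0 0 [Var 2, Var 5, Var 6, Var 4,
             stride])))
     (Seq (Assign 5 (Get 0 (Var 1)))
     (Seq sample_loop
          (Assign 0 (Var 2))))"

text \<open>A window gives up its first \<open>s\<close> elements when the element
  \<open>2 * s\<close> places in is below the pivot: those given up precede it by at least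
  \<open>s\<close> and so are smaller. One iteration either cuts or passes to the next array, which
  avoids a nested loop.\<close>

definition cut_low_loop :: com where
  "cut_low_loop =
    While (Less (Var 3) (Var 2))
          (If (And (Less (Add (Get 0 (Var 3)) (Add (Var 1) (Var 1))) (Get 1 (Var 3)))
                   (Elem_Less (Var 3) (Add (Get 0 (Var 3)) (Add (Var 1) (Var 1)))
                      (arr (Var 0) (Var 2)) (Div (Var 0) (Var 2))))
             (Seq (Put 0 (Var 3) (Add (Get 0 (Var 3)) (Var 1)))
                  (Assign 4 (Add (Var 4) (Var 1))))
             (Assign 3 (Add (Var 3) (Num 1))))"

definition cut_low_proc :: com where
  "cut_low_proc =
    Seq cut_low_loop
        (Assign 0 (Var 4))"

text \<open>The position \<open>hi - (2 * s + 1)\<close> lies \<open>2 * s\<close> places before the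
  last position \<open>hi - 1\<close> of the window.\<close>

definition cut_high_loop :: com where
  "cut_high_loop =
    While (Less (Var 3) (Var 2))
          (If (And (Less (Add (Get 0 (Var 3)) (Add (Var 1) (Var 1))) (Get 1 (Var 3)))
                   (Elem_Less (arr (Var 0) (Var 2)) (Div (Var 0) (Var 2))
                      (Var 3) (Sub (Get 1 (Var 3)) (Add (Add (Var 1) (Var 1)) (Num 1)))))
             (Seq (Put 1 (Var 3) (Sub (Get 1 (Var 3)) (Var 1)))
                  (Assign 4 (Add (Var 4) (Var 1))))
             (Assign 3 (Add (Var 3) (Num 1))))"

definition cut_high_proc :: com where
  "cut_high_proc =
    Seq cut_high_loop
        (Assign 0 (Var 4))"

text \<open>Variable 0 holds the number of arrays, 2 the rank, 3 the mass of the windows, 4 the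
  height of the tree, 5 the weight of thinning, 7 the sample distance. An element of the final list
  stands for \<open>Var 7 * Var 5\<close> window elements, whence the divisor in the pivot
  index.\<close>

definition round_com :: com where
  "round_com =
    Seq (Assign 7 (Div (Var 3) (Mul (Num 64) (Var 0))))
   (Seq (Call 8 1 [Var 4, Num 0, Num 0, Var 7, Var 0])
   (Seq (If (Less (Var 3) (Add (Var 2) (Var 2)))
          (Seq (Call 8 2 [Get 2 (Div (Div (Var 3) (Num 4)) (Mul (Var 7) (Var 5))), Var 7, Var 0])
               (Assign 2 (Sub (Var 2) (Var 8))))
          (Call 8 3 [Get 2 (Div (Sub (Var 3) (Div (Var 3) (Num 4))) (Mul (Var 7) (Var 5))),
             Var 7, Var 0]))
        (Assign 3 (Sub (Var 3) (Var 8)))))"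

definition init_loop :: com where
  "init_loop =
    While (Less (Var 4) (Var 0))
          (Seq (Put 1 (Var 4) (Len (Var 4)))
          (Seq (Assign 3 (Add (Var 3) (Len (Var 4))))
               (Assign 4 (Add (Var 4) (Num 1)))))"

text \<open>The height grows by 2, so \<open>Var 5\<close> is always the exact square root of the
  number of leaves, which is also the weight of an element of the final list.\<close>

definition level_loop :: com where
  "level_loop =
    While (Less (Mul (Var 5) (Var 5)) (Var 0))
          (Seq (Assign 5 (Add (Var 5) (Var 5)))
               (Assign 4 (Add (Var 4) (Num 2))))"

definition round_loop :: com where
  "round_loop =
    While (Less (Var 6) (Var 3)) round_com"

definition main_com :: com where
  "main_com =
    Seq init_loop
   (Seq (Assign 6 (Mul (Mul (Num 64) (Var 0)) (Add (Div (Var 3) (Var 1)) (Num 1))))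
   (Seq (Assign 4 (Num 0))
   (Seq (Assign 5 (Num 1))
   (Seq level_loop
   (Seq round_loop
        (Assign 0 (Var 2)))))))"

definition procs :: "com list" where
  "procs = [merge_proc, summ_proc, cut_low_proc, cut_high_proc]"

lemma procs_simps [simp]:
  "length procs = 4" "procs ! 0 = merge_proc" "procs ! Suc 0 = summ_proc"
  "procs ! 2 = cut_low_proc" "procs ! 3 = cut_high_proc"
  by (simp_all add: procs_def numeral_eq_Suc)

section \<open>Position codes and freedom from overflow\<close>

definition key :: "'a list list \<Rightarrow> nat \<Rightarrow> 'a" where
  "key A c = A ! (c mod length A) ! (c div length A)"

definition valid :: "'a list list \<Rightarrow> nat \<Rightarrow> bool" where
  "valid A c \<longleftrightarrow> A \<noteq> [] \<and> c div length A < length (A ! (c mod length A))"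

text \<open>Position codes stay below \<open>n * l\<close> and the threshold of the main loop is at
  most \<open>128 * n * l\<close>. The assumption \<open>word\<close> leaves room for both, so that
  no result in use is changed by the reduction modulo \<open>2 ^ w\<close>.\<close>

locale machine =
  fixes A :: "'a::linorder list list" and w :: nat
  assumes word: "8192 * (sum_list (map length A) + length A) ^ 3 \<le> 2 ^ w"
    and nonempty: "1 \<le> sum_list (map length A)"
begin

abbreviation n :: nat where "n \<equiv> sum_list (map length A)"
abbreviation l :: nat where "l \<equiv> length A"
abbreviation wpA where "wpA \<equiv> wp w A procs"

lemma l_pos: "1 \<le> l"
  using nonempty by (cases A) auto

lemma word_ge: "8192 * (n + l) \<le> 2 ^ w" "8192 * (n * l) \<le> 2 ^ w" "8192 * (l * l) \<le> 2 ^ w"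
proof -
  let ?Z = "n + l"
  have 1: "1 \<le> ?Z" using l_pos by simp
  have "?Z ^ 1 \<le> ?Z ^ 3" "?Z ^ 2 \<le> ?Z ^ 3" using 1 by (intro power_increasing; simp)+
  moreover have "n * l \<le> ?Z ^ 2" "l * l \<le> ?Z ^ 2" by (auto simp: power2_eq_square algebra_simps)
  ultimately show "8192 * ?Z \<le> 2 ^ w" "8192 * (n * l) \<le> 2 ^ w" "8192 * (l * l) \<le> 2 ^ w"
    using word by (simp_all add: algebra_simps)
qed

lemma word_n: "8192 * n \<le> 2 ^ w" and word_l: "8192 * l \<le> 2 ^ w"
  using word_ge(1) by simp_all

lemma word_gt: "8192 < (2::nat) ^ w"
proof -
  have "8192 < 8192 * (n + l)" using nonempty l_pos by simp
  then show ?thesis using word_ge(1) by (rule less_le_trans)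
qed

lemma eval_Num' [simp]: "c \<le> 8192 \<Longrightarrow> eval w A v m (Num c) = c"
  using word_ge(1) l_pos nonempty by simp

declare eval.simps(1) [simp del]

lemma length_nth_le: "i < l \<Longrightarrow> length (A ! i) \<le> n"
  by (metis elem_le_sum_list length_map nth_map)

lemma valid_bounds:
  assumes "valid A c"
  shows "c mod l < l" "c div l < n" "c < n * l" "c < 2 ^ w"
proof -
  show 1: "c mod l < l" using l_pos by (intro mod_less_divisor) linarith
  then show 2: "c div l < n" using assms length_nth_le[of "c mod l"] by (auto simp: valid_def)
  then show 3: "c < n * l"
    using l_pos by (metis div_less_iff_less_mult less_le_trans zero_less_one)
  then show "c < 2 ^ w" using word_ge(2) by linarith
qed

lemma eval_arr:
  assumes "valid A (eval w A v m c)" "eval w A v m e = l"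
  shows "eval w A v m (arr c e) = eval w A v m c mod l"
proof -
  let ?c = "eval w A v m c"
  have "?c div l * l \<le> ?c" by simp
  then have "?c div l * l < 2 ^ w" using valid_bounds(4)[OF assms(1)] by linarith
  then show ?thesis using assms(2) by (simp add: arr_def minus_div_mult_eq_mod)
qed

lemma test_key:
  assumes "valid A (eval w A v m e)" "valid A (eval w A v m f)" "eval w A v m g = l"
  shows "test w A v m (Elem_Less (arr e g) (Div e g) (arr f g) (Div f g)) \<longleftrightarrow>
    key A (eval w A v m e) < key A (eval w A v m f)"
  using assms valid_bounds(1)[OF assms(1)] valid_bounds(1)[OF assms(2)]
  by (simp add: eval_arr key_def valid_def)

lemma cost_arr [simp]: "expr_cost (arr c e) = 3 + 2 * expr_cost c + 2 * expr_cost e"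
  by (simp add: arr_def)


section \<open>Merging two lists on the stack\<close>

lemma merge_loop:
  assumes v: "v 0 = t0" "v 1 = t1" "v 2 = t2" "v 3 = l" "v 5 = t0" "v 6 = t1" "v 7 = 0"
    and t: "t0 \<le> t1" "t1 \<le> t2" "t2 < 2 ^ w"
    and val: "\<And>i. t0 \<le> i \<Longrightarrow> i < t2 \<Longrightarrow> valid A (m 2 i)"
  shows "wpA merge_loop (\<lambda>t v' m'. t \<le> 10 + 80 * (t2 - t0) \<and>
     v' 0 = t0 \<and> v' 4 = v 4 \<and> v' 7 = t2 - t0 \<and> v' 8 = v 8 \<and>
     (\<forall>a. a \<noteq> 3 \<longrightarrow> m' a = m a) \<and>
     map (m' 3) [0..<t2 - t0] = mrg (key A) (map (m 2) [t0..<t1]) (map (m 2) [t1..<t2])) v m"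
proof -
  define M where "M = mrg (key A) (map (m 2) [t0..<t1]) (map (m 2) [t1..<t2])"
  \<comment> \<open>The output so far, followed by the merge of what has not been read, is always
    the complete merge \<open>M\<close>.\<close>
  define I where "I \<tau> v' m' \<longleftrightarrow> v' 0 = t0 \<and> v' 1 = t1 \<and> v' 2 = t2 \<and> v' 3 = l \<and>
    v' 4 = v 4 \<and> v' 8 = v 8 \<and>
    t0 \<le> v' 5 \<and> v' 5 \<le> t1 \<and> t1 \<le> v' 6 \<and> v' 6 \<le> t2 \<and>
    v' 7 = (v' 5 - t0) + (v' 6 - t1) \<and> (\<forall>a. a \<noteq> 3 \<longrightarrow> m' a = m a) \<and>
    map (m' 3) [0..<v' 7] @ mrg (key A) (map (m 2) [v' 5..<t1]) (map (m 2) [v' 6..<t2]) = M \<and>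
    \<tau> = 10 + 80 * (t2 - t0 - v' 7)" for \<tau> and v' :: vars and m' :: memory
  show ?thesis
    unfolding merge_loop_def
  proof (rule wp_mono, rule wp_While[where I = I and \<tau> = "10 + 80 * (t2 - t0)"], goal_cases)
    case 1
    then show ?case using v t by (auto simp: I_def M_def)
  next
    case (2 \<tau> v' m')
    then have T: "\<forall>a. a \<noteq> 3 \<longrightarrow> m' a = m a"
      "map (m' 3) [0..<v' 7] @ mrg (key A) (map (m 2) [v' 5..<t1]) (map (m 2) [v' 6..<t2]) = M"
      by (auto simp: I_def)
    have I: "v' 0 = t0" "v' 1 = t1" "v' 2 = t2" "v' 3 = l" "v' 4 = v 4" "v' 8 = v 8"
      "t0 \<le> v' 5" "v' 5 \<le> t1" "t1 \<le> v' 6" "v' 6 \<le> t2" "v' 7 = (v' 5 - t0) + (v' 6 - t1)"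
      "\<tau> = 10 + 80 * (t2 - t0 - v' 7)" "v' 7 < t2 - t0"
      using 2 by (auto simp: I_def)
    have bd: "v' 5 < t1 \<Longrightarrow> Suc (v' 5) < 2 ^ w" "v' 6 < t2 \<Longrightarrow> Suc (v' 6) < 2 ^ w"
      "Suc (v' 5 - t0 + (v' 6 - t1)) < 2 ^ w"
      using I t by auto
    have up5: "v' 5 < t1 \<Longrightarrow> [v' 5..<t1] = v' 5 # [Suc (v' 5)..<t1]"
      and up6: "v' 6 < t2 \<Longrightarrow> [v' 6..<t2] = v' 6 # [Suc (v' 6)..<t2]"
      by (simp_all add: upt_conv_Cons)
    have T': "map (f(k := x)) [0..<k] = map f [0..<k]" for f and k x :: nat by simp
    have val5: "v' 5 < t1 \<Longrightarrow> valid A (m 2 (v' 5))" and val6: "v' 6 < t2 \<Longrightarrow> valid A (m 2 (v' 6))"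
      using val[of "v' 5"] val[of "v' 6"] I t by auto
    define left where "left \<longleftrightarrow> v' 5 < t1 \<and> \<not> (v' 6 < t2 \<and> \<not> key A (m 2 (v' 5)) < key A (m 2 (v' 6)))"
    have test: "test w A v' m' (And (Less (Var 5) (Var 1))
                     (Not (And (Less (Var 6) (Var 2))
                       (Not (Elem_Less
                         (arr (Get 2 (Var 5)) (Var 3)) (Div (Get 2 (Var 5)) (Var 3))
                         (arr (Get 2 (Var 6)) (Var 3)) (Div (Get 2 (Var 6)) (Var 3))))))) = left"
      using I T(1) val5 val6 by (cases "v' 5 < t1"; cases "v' 6 < t2")
        (simp_all add: left_def test_key del: test.simps(2))
    show ?case
    proof (cases left)
      case True
      then have lt: "v' 5 < t1" by (simp add: left_def)
      have "map ((m' 3)(v' 7 := m 2 (v' 5))) [0..<Suc (v' 7)] @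
        mrg (key A) (map (m 2) [Suc (v' 5)..<t1]) (map (m 2) [v' 6..<t2]) = M"
        using T(2) True lt up5 up6 T' by (cases "v' 6 < t2") (auto simp: left_def)
      then show ?thesis unfolding wp_Seq wp_If test using I bd lt True T(1)
        by (simp add: I_def Suc_diff_le, linarith?)
    next
      case False
      then have lt: "v' 6 < t2" using I by (auto simp: left_def)
      have "map ((m' 3)(v' 7 := m 2 (v' 6))) [0..<Suc (v' 7)] @
        mrg (key A) (map (m 2) [v' 5..<t1]) (map (m 2) [Suc (v' 6)..<t2]) = M"
        using T(2) False lt up5 up6 T' by (cases "v' 5 < t1") (auto simp: left_def)
      then show ?thesis unfolding wp_Seq wp_If test using I bd lt False T(1)
        by (simp add: I_def Suc_diff_le, linarith?)
    qed
  next
    case (3 \<tau> v' m')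
    then show ?case by (auto simp: I_def)
  next
    case (4 t v' m')
    then have "v' 5 = t1" "v' 6 = t2" "v' 7 = t2 - t0" by (auto simp: I_def)
    moreover from 4 have "map (m' 3) [0..<v' 7] @
        mrg (key A) (map (m 2) [v' 5..<t1]) (map (m 2) [v' 6..<t2]) = M"
      by (auto simp: I_def)
    ultimately have "map (m' 3) [0..<t2 - t0] = M" by simp
    then show ?case using 4 \<open>v' 7 = t2 - t0\<close> unfolding I_def M_def by blast
  qed
qed

lemma copy_loop:
  assumes v: "v 0 = t0" "v 4 = d" "v 7 = N" "v 8 = 0"
    and N: "t0 + N < 2 ^ w" and d: "d = 1 \<or> d = 2"
  shows "wpA copy_loop (\<lambda>t v' m'. t \<le> 10 + 30 * N \<and> v' 0 = t0 \<and> v' 8 = N div d \<and>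
     (\<forall>a. a \<noteq> 2 \<longrightarrow> m' a = m a) \<and> (\<forall>i<t0. m' 2 i = m 2 i) \<and>
     (\<forall>x<N div d. m' 2 (t0 + x) = m 3 (x * d + d - 1))) v m"
proof -
  define I where "I \<tau> v' m' \<longleftrightarrow> v' 0 = t0 \<and> v' 4 = d \<and> v' 7 = N \<and> v' 8 \<le> N div d \<and>
     (\<forall>a. a \<noteq> 2 \<longrightarrow> m' a = m a) \<and> (\<forall>i<t0. m' 2 i = m 2 i) \<and>
     (\<forall>x<v' 8. m' 2 (t0 + x) = m 3 (x * d + d - 1)) \<and> \<tau> = 10 + 30 * (N div d - v' 8)"
    for \<tau> and v' :: vars and m' :: memory
  have div_le: "N div d \<le> N" by simp
  show ?thesis
    unfolding copy_loop_def
  proof (rule wp_mono, rule wp_While[where I = I and \<tau> = "10 + 30 * (N div d)"], goal_cases)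
    case 1
    then show ?case using v by (auto simp: I_def)
  next
    case (2 \<tau> v' m')
    then have S: "\<forall>a. a \<noteq> 2 \<longrightarrow> m' a = m a" "\<forall>i<t0. m' 2 i = m 2 i"
        "\<forall>x<v' 8. m' 2 (t0 + x) = m 3 (x * d + d - 1)"
      by (auto simp: I_def)
    have I: "v' 0 = t0" "v' 4 = d" "v' 7 = N" "v' 8 < N div d" "\<tau> = 10 + 30 * (N div d - v' 8)"
      using 2 by (auto simp: I_def)
    have "v' 8 * d + d - 1 < N" using dec_index[of d "v' 8" N] d I(4) by auto
    moreover have "1 < (2::nat) ^ w" using word_gt by linarith
    ultimately have "v' 8 * d + d < 2 ^ w" "t0 + v' 8 < 2 ^ w" "Suc (v' 8) < 2 ^ w" "v' 8 * d < 2 ^ w"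
      using d N I(4) div_le by auto
    then show ?case using I S by (simp add: I_def less_Suc_eq all_conj_distrib)
  next
    case (3 \<tau> v' m')
    then show ?case by (auto simp: I_def)
  next
    case (4 t v' m')
    have "30 * (N div d) \<le> 30 * N" using div_le by (rule mult_le_mono2)
    then have "t \<le> 10 + 30 * N" using 4 by linarith
    moreover have "v' 0 = t0" "v' 8 = N div d" using 4 by (auto simp: I_def)
    ultimately show ?case using 4 unfolding I_def by auto
  qed
qed

lemma merge_spec:
  assumes t: "t0 \<le> t1" "t1 \<le> t2" "t2 < 2 ^ w" and d: "d = 1 \<or> d = 2"
    and X: "X = map (m 2) [t0..<t1]" and Y: "Y = map (m 2) [t1..<t2]"
    and val: "\<And>c. c \<in> set X \<union> set Y \<Longrightarrow> valid A c"
    and Z: "Z = dec d (mrg (key A) X Y)"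
  shows "wpA merge_proc (\<lambda>t v' m'. t \<le> 50 + 120 * (t2 - t0) \<and> v' 0 = t0 + length Z \<and>
    m' 0 = m 0 \<and> m' 1 = m 1 \<and> (\<forall>i<t0. m' 2 i = m 2 i) \<and>
    map (m' 2) [t0..<t0 + length Z] = Z) (frame [t0, t1, t2, l, d]) m"
proof -
  let ?v = "(frame [t0, t1, t2, l, d])(5 := t0, 6 := t1)"
  have val': "valid A (m 2 i)" if "t0 \<le> i" "i < t2" for i
    using that t val[of "m 2 i"] by (cases "i < t1") (auto simp: X Y)
  define N where "N = t2 - t0"
  have N: "t0 + N < 2 ^ w" "N = length (mrg (key A) X Y)" using t by (auto simp: N_def X Y)
  have lenZ: "length Z = N div d" using N(2) by (simp add: Z)
  have "N div d \<le> N" by simp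
  then have lt: "t0 + length Z < 2 ^ w" using N(1) unfolding lenZ by linarith
  have loop: "wpA merge_loop (\<lambda>t v' m'. t \<le> 10 + 80 * N \<and>
     v' 0 = t0 \<and> v' 4 = d \<and> v' 7 = N \<and> v' 8 = 0 \<and>
     (\<forall>a. a \<noteq> 3 \<longrightarrow> m' a = m a) \<and> map (m' 3) [0..<N] = mrg (key A) X Y) ?v m"
    by (rule wp_mono, rule merge_loop[of _ t0 t1 t2])
      (use t val' in \<open>auto simp: frame_def N_def X Y nth_Cons'\<close>)
  have fin: "wpA (Seq copy_loop (Assign 0 (Add (Var 0) (Var 8)))) (\<lambda>s v'' m''.
      s \<le> 20 + 30 * N \<and> v'' 0 = t0 + length Z \<and>
      m'' 0 = m 0 \<and> m'' 1 = m 1 \<and> (\<forall>i<t0. m'' 2 i = m 2 i) \<and>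
      map (m'' 2) [t0..<t0 + length Z] = Z) v' m'"
    if v: "v' 0 = t0" "v' 4 = d" "v' 7 = N" "v' 8 = 0" "\<forall>a. a \<noteq> 3 \<longrightarrow> m' a = m a"
      "map (m' 3) [0..<N] = mrg (key A) X Y" for v' m'
  proof -
    have nth: "mrg (key A) X Y ! j = m' 3 j" if "j < N" for j
      using that by (simp flip: v(6))
    have Zi: "Z ! x = m' 3 (x * d + d - 1)" if "x < N div d" for x
      using that nth[of "x * d + d - 1"] dec_index[of d x N] d N(2) by (auto simp: Z dec_def)
    show ?thesis unfolding wp_Seq wp_Assign
    proof (rule wp_mono, rule copy_loop[of v' t0 d N], goal_cases)
      case (7 t v'' m'')
      then have m'': "v'' 0 = t0" "v'' 8 = length Z" "\<forall>a. a \<noteq> 2 \<longrightarrow> m'' a = m' a"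
        "\<forall>i<t0. m'' 2 i = m' 2 i" "\<forall>x<length Z. m'' 2 (t0 + x) = m' 3 (x * d + d - 1)"
        "t \<le> 10 + 30 * N" by (auto simp: lenZ)
      have "map (m'' 2) [t0..<t0 + length Z] = Z"
        using m''(5) Zi lenZ by (intro nth_equalityI) auto
      then show ?case using m'' v lt by auto
    qed (use v N(1) d word_gt in auto)
  qed
  have start: "frame [t0, t1, t2, l, d] 0 = t0" "((frame [t0, t1, t2, l, d])(5 := t0)) 1 = t1"
    by (simp_all add: frame_def)
  show ?thesis
    unfolding merge_proc_def wp_Seq[of _ _ _ _ "Seq _ (Seq _ _)"] wp_Seq[of _ _ _ merge_loop] wp_Assign eval.simps start
    apply (rule wp_mono[OF loop])
    apply (rule wp_mono[OF fin])
    apply (auto simp: N_def)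
    done
qed

end

section \<open>Sampling the windows\<close>

text \<open>The number of samples is the window length divided by \<open>s\<close> and rounded up: a
  nonempty window always contributes its first position, and fewer than \<open>s\<close> positions
  follow the last sample.\<close>

definition samples :: "nat \<Rightarrow> (nat \<Rightarrow> nat) \<Rightarrow> (nat \<Rightarrow> nat) \<Rightarrow> nat \<Rightarrow> nat \<Rightarrow> nat list" where
  "samples l lo hi s i = map (\<lambda>j. (lo i + j * s) * l + i) [0..<(hi i - lo i + s - 1) div s]"

lemma less_ceil_div: "1 \<le> s \<Longrightarrow> j < (x + s - 1) div s \<longleftrightarrow> j * s < (x::nat)"
proof -
  assume s: "1 \<le> s"
  have "j < (x + s - 1) div s \<longleftrightarrow> Suc j * s \<le> x + s - 1"
    using s by (simp add: less_eq_div_iff_mult_less_eq flip: Suc_le_eq)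
  also have "\<dots> \<longleftrightarrow> j * s < x" using s by auto
  finally show ?thesis .
qed

lemma distinct_concat_nth:
  assumes "distinct (concat A)" "b < length A" "c < length A" "p < length (A ! b)"
    "q < length (A ! c)" "A ! b ! p = A ! c ! q"
  shows "b = c \<and> p = q"
  using assms
proof (induction A arbitrary: b c)
  case (Cons X A)
  have disj: "set X \<inter> set Y = {}" if "Y \<in> set A" for Y using Cons.prems(1) that by auto
  show ?case
  proof (cases b; cases c)
    fix b' c' assume "b = Suc b'" "c = Suc c'"
    then show ?thesis using Cons.IH[of b' c'] Cons.prems by simp
  next
    fix c' assume "b = 0" "c = Suc c'"
    then show ?thesis using Cons.prems disj[of "A ! c'"] nth_mem[of p X] nth_mem[of q "A ! c'"]
      by (auto dest: nth_mem)
  next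
    fix b' assume "b = Suc b'" "c = 0"
    then show ?thesis using Cons.prems disj[of "A ! b'"] nth_mem[of q X] nth_mem[of p "A ! b'"]
      by (auto dest: nth_mem)
  next
    assume "b = 0" "c = 0"
    then show ?thesis using Cons.prems by (auto simp: nth_eq_iff_index_eq)
  qed
qed auto

text \<open>\<open>spaced\<close> is all that remains of u-sortedness, at the sample distance of the
  current round. It speaks of whole arrays and so survives any shrinking of the windows.
  \<open>out\<close> makes the leaves beyond the last array empty, so that a full binary tree serves
  every \<open>l\<close>.\<close>

locale windows = machine A w for A :: "'a::linorder list list" and w :: nat +
  fixes lo hi :: "nat \<Rightarrow> nat" and s :: nat
  assumes dist: "distinct (concat A)"
    and win: "\<And>i. i < length A \<Longrightarrow> lo i \<le> hi i" "\<And>i. i < length A \<Longrightarrow> hi i \<le> length (A ! i)"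
    and out: "\<And>i. length A \<le> i \<Longrightarrow> hi i = 0" "\<And>i. length A \<le> i \<Longrightarrow> lo i = 0"
    and s: "1 \<le> s" "s \<le> sum_list (map length A)"
    and spaced: "\<And>i p q. i < length A \<Longrightarrow> p + s \<le> q \<Longrightarrow> q < length (A ! i) \<Longrightarrow>
      A ! i ! p < A ! i ! q"
begin

abbreviation sm :: "nat \<Rightarrow> nat list" where "sm \<equiv> samples l lo hi s"

lemma code_simps: "i < l \<Longrightarrow> (p * l + i) mod l = i" "i < l \<Longrightarrow> (p * l + i) div l = p"
  by (simp, subst div_mult_self3) auto

lemma sm_out: "l \<le> i \<Longrightarrow> sm i = []"
  using out[of i] s by (simp add: samples_def)

lemma length_sm: "length (sm i) = (hi i - lo i + s - 1) div s"
  by (simp add: samples_def)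

lemma sm_nth: "j < length (sm i) \<Longrightarrow> sm i ! j = (lo i + j * s) * l + i"
  by (simp add: samples_def)

lemma sm_index: "j < length (sm i) \<longleftrightarrow> lo i + j * s < hi i"
  unfolding length_sm less_ceil_div[OF s(1)] by auto

lemma sm_index_l: "j < length (sm i) \<Longrightarrow> i < l"
  using out[of i] by (cases "i < l") (auto simp: sm_index)

lemma key_sm: "j < length (sm i) \<Longrightarrow> key A (sm i ! j) = A ! i ! (lo i + j * s)"
  using code_simps[OF sm_index_l] by (simp add: sm_nth key_def)

lemma sm_pos: "j < length (sm i) \<Longrightarrow> lo i + j * s < length (A ! i)"
  using sm_index sm_index_l win(2) less_le_trans by blast

lemma ssorted_sm: "ssorted (key A) (sm i)"
  unfolding ssorted_def sorted_wrt_iff_nth_less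
proof (intro allI impI)
  fix j k assume jk: "j < k" "k < length (sm i)"
  have "Suc j * s \<le> k * s" using jk by (intro mult_le_mono1) simp
  then show "key A (sm i ! j) < key A (sm i ! k)"
    using jk sm_pos[OF jk(2)] sm_index_l[OF jk(2)] by (auto simp: key_sm intro!: spaced)
qed

lemma sm_keys_disjoint:
  assumes "b \<noteq> c" "x \<in> set (sm b)" "y \<in> set (sm c)"
  shows "key A x \<noteq> key A y"
proof -
  obtain j k where "j < length (sm b)" "x = sm b ! j" "k < length (sm c)" "y = sm c ! k"
    using assms by (auto simp: in_set_conv_nth)
  then show ?thesis
    using distinct_concat_nth[OF dist, of b c] assms(1)
    using sm_pos sm_index_l by (auto simp: key_sm)
qed

lemma valid_sm: "x \<in> set (sm b) \<Longrightarrow> valid A x"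
proof -
  assume "x \<in> set (sm b)"
  then obtain j where j: "j < length (sm b)" "x = sm b ! j" by (auto simp: in_set_conv_nth)
  then show ?thesis
    using sm_pos[OF j(1)] sm_index_l[OF j(1)] by (auto simp: valid_def sm_nth code_simps)
qed

lemma summ_subset: "set (summ (key A) sm j a) \<subseteq> (\<Union>b\<in>leaves j a. set (sm b))"
  and ssorted_summ: "ssorted (key A) (summ (key A) sm j a)"
  using summ_props[of "key A" sm j a] ssorted_sm sm_keys_disjoint by blast+

lemma summ_length_le: "length (summ (key A) sm j a) \<le> (\<Sum>b\<in>leaves j a. length (sm b))"
proof -
  have "1 * length (summ (key A) sm j a) \<le> 2 ^ (j div 2) * length (summ (key A) sm j a)"
    by (intro mult_le_mono1) simp
  also have "\<dots> \<le> (\<Sum>b\<in>leaves j a. length (sm b))"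
    using summ_length[of "key A" sm j a] ssorted_sm sm_keys_disjoint by blast
  finally show ?thesis by simp
qed

lemma valid_summ: "x \<in> set (summ (key A) sm j a) \<Longrightarrow> valid A x"
  using summ_subset[of j a] valid_sm by blast

section \<open>The sampling and summary procedures\<close>

lemma sample_loop:
  fixes v :: vars and m :: memory
  assumes v: "v 1 = i" "v 2 = tp" "v 3 = s" "v 4 = l" "v 5 = lo i"
    and m: "m 0 = lo" "m 1 = hi" and tp: "tp + length (sm i) < 2 ^ w"
  shows "wpA sample_loop (\<lambda>t v' m'. t \<le> 10 + 40 * length (sm i) \<and> v' 2 = tp + length (sm i) \<and>
     (\<forall>a. a \<noteq> 2 \<longrightarrow> m' a = m a) \<and> (\<forall>x<tp. m' 2 x = m 2 x) \<and>
     map (m' 2) [tp..<tp + length (sm i)] = sm i) v m"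
proof -
  define K where "K = length (sm i)"
  define I where "I \<tau> v' m' \<longleftrightarrow> v' 1 = i \<and> v' 3 = s \<and> v' 4 = l \<and> tp \<le> v' 2 \<and> v' 2 - tp \<le> K \<and>
     v' 5 = lo i + (v' 2 - tp) * s \<and> (\<forall>a. a \<noteq> 2 \<longrightarrow> m' a = m a) \<and> (\<forall>x<tp. m' 2 x = m 2 x) \<and>
     (\<forall>x<v' 2 - tp. m' 2 (tp + x) = (lo i + x * s) * l + i) \<and> \<tau> = 10 + 40 * (K - (v' 2 - tp))"
    for \<tau> and v' :: vars and m' :: memory
  show ?thesis
    unfolding sample_loop_def
  proof (rule wp_mono, rule wp_While[where I = I and \<tau> = "10 + 40 * K"], goal_cases)
    case 1
    then show ?case using v by (auto simp: I_def)
  next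
    case (2 \<tau> v' m')
    then have I: "v' 1 = i" "v' 3 = s" "v' 4 = l" "v' 5 = lo i + (v' 2 - tp) * s" "tp \<le> v' 2"
        "\<forall>a. a \<noteq> 2 \<longrightarrow> m' a = m a" "\<forall>x<tp. m' 2 x = m 2 x"
        "\<forall>x<v' 2 - tp. m' 2 (tp + x) = (lo i + x * s) * l + i" "\<tau> = 10 + 40 * (K - (v' 2 - tp))"
        "v' 5 < hi i"
      using m by (auto simp: I_def)
    define j where "j = v' 2 - tp"
    have j: "v' 2 = tp + j" using I(5) by (simp add: j_def)
    have jK: "j < length (sm i)" using I j by (simp add: sm_index)
    have il: "i < l" using sm_index_l[OF jK] .
    have p: "lo i + j * s < n" using sm_pos[OF jK] length_nth_le[OF il] by linarith
    have code: "valid A ((lo i + j * s) * l + i)"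
      using valid_sm[OF nth_mem[OF jK]] sm_nth[OF jK] by simp
    have b: "(lo i + j * s) * l + i < 2 ^ w" using valid_bounds(4)[OF code] .
    then have b': "(lo i + j * s) * l < 2 ^ w" by linarith
    have b2: "lo i + j * s + s < 2 ^ w"
      using p s(2) word_n by linarith
    have b3: "Suc (tp + j) < 2 ^ w" using jK tp by linarith
    show ?case using I j jK b b' b2 b3
      by (simp add: I_def K_def less_Suc_eq all_conj_distrib add_ac, linarith?)
  next
    case (3 \<tau> v' m')
    then show ?case by (auto simp: I_def)
  next
    case (4 t v' m')
    then obtain \<tau> where I: "I \<tau> v' m'" "t \<le> 10 + 40 * K" "\<not> v' 5 < m' 1 (v' 1)" by auto
    define j where "j = v' 2 - tp"
    have "\<not> j < K" using I m by (auto simp: I_def K_def sm_index j_def)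
    then have j: "j = K" "v' 2 = tp + K" using I(1) by (auto simp: I_def j_def)
    then have "map (m' 2) [tp..<tp + K] = sm i"
      using I(1) by (intro nth_equalityI) (auto simp: I_def K_def sm_nth)
    then show ?case using I j by (auto simp: I_def K_def)
  qed
qed

lemma eval_stride:
  assumes "v 0 = k" "k < 2 ^ w"
  shows "eval w A v m stride = (if even k then 2 else 1)"
proof -
  have "2 * (k div 2) < 2 ^ w" using assms(2) by linarith
  then show ?thesis using assms(1) by (auto simp: stride_def elim!: oddE)
qed

lemma cost_stride [simp]: "expr_cost stride = 9"
  by (simp add: stride_def)

text \<open>The clause on the cells below \<open>tp\<close> carries the recursion: it keeps the left
  list intact while the right subtree is processed. Since summaries are never longer than the
  samples below them, the stack needs no more room than those samples.\<close>

lemma summ_spec: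
  assumes "m 0 = lo" "m 1 = hi" "(a + 1) * 2 ^ j < 2 ^ w"
    and "tp + (\<Sum>b\<in>leaves j a. length (sm b)) < 2 ^ w"
  shows "wpA summ_proc (\<lambda>t v' m'. t \<le> scost (key A) sm j a \<and>
    v' 0 = tp + length (summ (key A) sm j a) \<and> m' 0 = lo \<and> m' 1 = hi \<and>
    (\<forall>i<tp. m' 2 i = m 2 i) \<and>
    map (m' 2) [tp..<tp + length (summ (key A) sm j a)] = summ (key A) sm j a)
    (frame [j, a, tp, s, l]) m"
  using assms
proof (induction j arbitrary: a tp m)
  case 0
  have f: "frame [0, a, tp, s, l] 0 = 0"  "frame [0, a, tp, s, l] 1 = a"
     "frame [0, a, tp, s, l] 2 = tp" "frame [0, a, tp, s, l] 3 = s" "frame [0, a, tp, s, l] 4 = l"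
    by (simp_all add: frame_def)
  have t: "\<not> test w A (frame [0, a, tp, s, l]) m (Less (Num 0) (Var 0))" using f by simp
  show ?case unfolding summ_proc_def wp_If if_not_P[OF t] wp_Seq wp_Assign eval.simps f 0(1)
    by (rule wp_mono, rule sample_loop[of _ a tp]) (use 0 f in auto)
next
  case (Suc j)
  let ?v = "frame [Suc j, a, tp, s, l]"
  let ?L = "summ (key A) sm j (2 * a)" and ?R = "summ (key A) sm j (2 * a + 1)"
  let ?Z = "summ (key A) sm (Suc j) a"
  have f: "?v 0 = Suc j"  "?v (Suc 0) = a" "?v 2 = tp" "?v 3 = s" "?v 4 = l"
    by (simp_all add: frame_def)
  have t: "test w A ?v m (Less (Num 0) (Var 0))" using f by simp
  have sum: "(\<Sum>b\<in>leaves (Suc j) a. length (sm b)) =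
    (\<Sum>b\<in>leaves j (2 * a). length (sm b)) + (\<Sum>b\<in>leaves j (2 * a + 1). length (sm b))"
    unfolding leaves_Suc by (rule sum.union_disjoint) auto
  have a: "(2 * a + 1) * 2 ^ j < 2 ^ w" "(2 * a + 1 + 1) * 2 ^ j < 2 ^ w"
    using Suc.prems(3) by (auto simp: algebra_simps)
  have "(a + 1) * 2 ^ 1 \<le> (a + 1) * 2 ^ Suc j" by (intro mult_le_mono2 power_increasing) auto
  then have a2: "2 * a < 2 ^ w" "Suc (2 * a) < 2 ^ w" using Suc.prems(3) by simp_all
  have "Suc j < 2 ^ Suc j" by (rule less_exp)
  also have "\<dots> \<le> (a + 1) * 2 ^ Suc j" by simp
  finally have j: "Suc j < 2 ^ w" using Suc.prems(3) by linarith
  define t1 where "t1 = tp + length ?L"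
  define t2 where "t2 = t1 + length ?R"
  have tp: "tp + (\<Sum>b\<in>leaves j (2 * a). length (sm b)) < 2 ^ w"
    "t1 + (\<Sum>b\<in>leaves j (2 * a + 1). length (sm b)) < 2 ^ w" "t2 < 2 ^ w"
    using Suc.prems(4) summ_length_le[of j "2 * a"] summ_length_le[of j "2 * a + 1"]
    unfolding sum t1_def t2_def by linarith+
  define d :: nat where "d = (if even (Suc j) then 2 else 1)"
  have stride: "eval w A v m stride = d" if "v 0 = Suc j" for v m
    using eval_stride[where v = v, OF that j] by (simp add: d_def)
  have Z: "?Z = dec d (mrg (key A) ?L ?R)" by (simp add: d_def)
  have cost: "scost (key A) sm (Suc j) a = 150 + scost (key A) sm j (2 * a) +
      scost (key A) sm j (Suc (2 * a)) + 150 * (t2 - tp)"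
    by (simp add: t1_def t2_def)
  have le: "tp \<le> t1" "t1 \<le> t2" by (auto simp: t1_def t2_def)
  have merge: "wpA merge_proc (\<lambda>t v' m'. t \<le> 50 + 120 * (t2 - tp) \<and> v' 0 = tp + length ?Z \<and>
      m' 0 = lo \<and> m' 1 = hi \<and> (\<forall>i<tp. m' 2 i = m2 2 i) \<and>
      map (m' 2) [tp..<tp + length ?Z] = ?Z) (frame [tp, t1, t2, l, d]) m2"
    if "m2 0 = lo" "m2 1 = hi" "map (m2 2) [tp..<t1] = ?L" "map (m2 2) [t1..<t2] = ?R" for m2
    by (rule wp_mono[OF merge_spec[where m = m2, OF le tp(3) _ that(3)[symmetric] that(4)[symmetric] _ Z]])
      (use valid_summ that in \<open>auto simp: d_def simp del: summ.simps\<close>)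
  have keep: "map (m2 2) [tp..<t1] = map (m1 2) [tp..<t1]" if "\<forall>i<t1. m2 2 i = m1 2 i"
    for m1 m2 :: memory using that by auto
  have right: "wpA summ_proc (\<lambda>t v' m'. t \<le> scost (key A) sm j (Suc (2 * a)) \<and>
      v' 0 = t2 \<and> m' 0 = lo \<and> m' 1 = hi \<and> (\<forall>i<t1. m' 2 i = m1 2 i) \<and>
      map (m' 2) [t1..<t2] = ?R) (frame [j, Suc (2 * a), t1, s, l]) m1"
    if "m1 0 = lo" "m1 1 = hi" for m1
    using Suc.IH[OF that a(2) tp(2)] by (simp only: t2_def Suc_eq_plus1)
  show ?case unfolding summ_proc_def wp_If if_P[OF t] wp_Seq wp_Call
    apply (simp add: f Suc.prems(1,2) a2 stride del: summ.simps scost.simps)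
    apply (rule wp_mono[OF Suc.IH[OF Suc.prems(1,2) a(1) tp(1)]])
    apply (elim conjE)
    apply (simp only: t1_def[symmetric])
    apply (rule wp_mono[OF right], assumption, assumption)
    apply (elim conjE)
    subgoal for t1' v1 m1 t2' v2 m2
      apply (simp only:)
      apply (rule wp_mono[OF merge], assumption, assumption)
      subgoal using keep[of m2 m1] by simp
      subgoal by assumption
      subgoal using le by (simp add: cost del: summ.simps scost.simps)
    done
  done
qed

end

section \<open>Ranks inside the windows and their cuts\<close>

definition wrk :: "'a::linorder list list \<Rightarrow> (nat \<Rightarrow> nat) \<Rightarrow> (nat \<Rightarrow> nat) \<Rightarrow> nat \<Rightarrow> 'a \<Rightarrow> nat" where
  "wrk A lo hi i x = card {q. lo i \<le> q \<and> q < hi i \<and> A ! i ! q < x}"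

definition wrank :: "'a::linorder list list \<Rightarrow> (nat \<Rightarrow> nat) \<Rightarrow> (nat \<Rightarrow> nat) \<Rightarrow> 'a \<Rightarrow> nat" where
  "wrank A lo hi x = (\<Sum>i<length A. wrk A lo hi i x)"

definition wmass :: "'a list list \<Rightarrow> (nat \<Rightarrow> nat) \<Rightarrow> (nat \<Rightarrow> nat) \<Rightarrow> nat" where
  "wmass A lo hi = (\<Sum>i<length A. hi i - lo i)"

definition wins :: "'a list list \<Rightarrow> (nat \<Rightarrow> nat) \<Rightarrow> (nat \<Rightarrow> nat) \<Rightarrow> bool" where
  "wins A lo hi \<longleftrightarrow> (\<forall>i<length A. lo i \<le> hi i \<and> hi i \<le> length (A ! i)) \<and>
     (\<forall>i\<ge>length A. lo i = 0 \<and> hi i = 0)"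

text \<open>The invariant of the main loop about the element sought. Being strict, the inequalities
  force \<open>y\<close> itself into a window; \<open>Suc\<close> is there because ranks start at
  1.\<close>

definition target ::
  "'a::linorder list list \<Rightarrow> (nat \<Rightarrow> nat) \<Rightarrow> (nat \<Rightarrow> nat) \<Rightarrow> 'a \<Rightarrow> nat \<Rightarrow> bool" where
  "target A lo hi y k \<longleftrightarrow> (\<exists>i<length A. \<exists>q<length (A ! i). A ! i ! q = y) \<and>
     (\<forall>i<length A. (\<forall>q<lo i. A ! i ! q < y) \<and>
        (\<forall>q. hi i \<le> q \<and> q < length (A ! i) \<longrightarrow> y < A ! i ! q)) \<and>
     k = Suc (wrank A lo hi y)"

context windows
begin

abbreviation "rk \<equiv> wrk A lo hi"
abbreviation "rank \<equiv> wrank A lo hi"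
abbreviation "mass \<equiv> wmass A lo hi"

lemma down_key: "down (key A) (\<lambda>c. key A c < x)"
  by (auto simp: down_def)

text \<open>Samples only bracket the rank, since windows are not sorted. Elements at least
  \<open>s\<close> after the first sample that is not small are not small either; elements at least
  \<open>s\<close> before the last small sample, which has index \<open>c i - 1\<close>, are
  small.\<close>

lemma rk_cnt:
  fixes x defines "c i \<equiv> cnt (\<lambda>c. key A c < x) (sm i)"
  assumes i: "i < l"
  shows "rk i x \<le> (c i + 1) * s" "c i * s \<le> rk i x + 2 * s"
proof -
  have iff: "A ! i ! (lo i + j * s) < x \<longleftrightarrow> j < c i" if "lo i + j * s < hi i" for j
    using ssorted_cnt_iff[OF ssorted_sm down_key, of j i] key_sm[of j i] that
    by (simp add: c_def sm_index)
  have "{q. lo i \<le> q \<and> q < hi i \<and> A ! i ! q < x} \<subseteq> {lo i..<lo i + (c i + 1) * s}"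
  proof safe
    fix q assume q: "lo i \<le> q" "q < hi i" "A ! i ! q < x"
    show "q \<in> {lo i..<lo i + (c i + 1) * s}"
    proof (rule ccontr)
      assume "q \<notin> {lo i..<lo i + (c i + 1) * s}"
      then have ge: "lo i + c i * s + s \<le> q" using q by auto
      then have "\<not> A ! i ! (lo i + c i * s) < x" using iff[of "c i"] q by auto
      moreover have "A ! i ! (lo i + c i * s) < A ! i ! q"
        using ge q win(2)[OF i] by (intro spaced[OF i]) auto
      ultimately show False using q by auto
    qed
  qed
  from card_mono[OF _ this] show "rk i x \<le> (c i + 1) * s" by (simp add: wrk_def)
  show "c i * s \<le> rk i x + 2 * s"
  proof (cases "c i < 2")
    case True
    then have "c i * s \<le> 2 * s" by (intro mult_le_mono1) simp
    then show ?thesis by linarith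
  next
    case False
    define d where "d = c i - 2"
    have d: "c i = d + 2" using False by (simp add: d_def)
    have "c i \<le> length (sm i)" unfolding c_def by (rule cnt_le_length)
    then have top: "lo i + (d + 1) * s < hi i" using d sm_index[of "d + 1" i] by auto
    have lt: "A ! i ! (lo i + (d + 1) * s) < x" using iff[OF top] d by simp
    have "{lo i..<lo i + d * s} \<subseteq> {q. lo i \<le> q \<and> q < hi i \<and> A ! i ! q < x}"
    proof safe
      fix q assume q: "q \<in> {lo i..<lo i + d * s}"
      then have "A ! i ! q < A ! i ! (lo i + (d + 1) * s)"
        using top win(2)[OF i] by (intro spaced[OF i]) auto
      with lt show "A ! i ! q < x" by order
      show "lo i \<le> q" "q < hi i" using q top by auto
    qed
    from card_mono[OF _ this] have "d * s \<le> rk i x" by (simp add: wrk_def)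
    then show ?thesis by (simp add: d algebra_simps)
  qed
qed

lemma length_sm_bounds:
  "hi i - lo i \<le> length (sm i) * s" "length (sm i) * s \<le> hi i - lo i + s"
  "length (sm i) \<le> hi i - lo i"
proof -
  show "hi i - lo i \<le> length (sm i) * s" using sm_index[of "length (sm i)" i] by auto
  have "length (sm i) * s \<le> hi i - lo i + s \<and> length (sm i) \<le> hi i - lo i"
  proof (cases "length (sm i)")
    case (Suc k)
    then have k: "lo i + k * s < hi i" using sm_index[of k i] by simp
    moreover have "k \<le> k * s" using s(1) by (cases s) auto
    ultimately have "Suc k \<le> hi i - lo i" by linarith
    then show ?thesis using Suc k by simp
  qed auto
  then show "length (sm i) * s \<le> hi i - lo i + s" "length (sm i) \<le> hi i - lo i" by auto
qed

lemma sum_leaves: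
  assumes "l \<le> 2 ^ J" and "\<And>b. sm b = [] \<Longrightarrow> g b = 0"
  shows "(\<Sum>b\<in>leaves J 0. g b) = (\<Sum>b<l. g b)"
  using assms sm_out by (intro sum.mono_neutral_right) (auto simp: leaves_def)

lemma mass_le: "mass \<le> n"
proof -
  have "mass \<le> (\<Sum>i<l. length (A ! i))"
    unfolding wmass_def using win(2) by (intro sum_mono) (auto intro: le_trans[OF diff_le_self])
  also have "\<dots> = n" by (simp add: sum_list_sum_nth lessThan_atLeast0)
  finally show ?thesis .
qed

lemma sum_length_sm:
  assumes "l \<le> 2 ^ J"
  shows "(\<Sum>b\<in>leaves J 0. length (sm b)) \<le> mass"
    "(\<Sum>b\<in>leaves J 0. length (sm b)) * s \<le> mass + l * s"
    "mass \<le> (\<Sum>b\<in>leaves J 0. length (sm b)) * s"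
proof -
  have eq: "(\<Sum>b\<in>leaves J 0. length (sm b)) = (\<Sum>b<l. length (sm b))"
    by (rule sum_leaves[OF assms]) auto
  show "(\<Sum>b\<in>leaves J 0. length (sm b)) \<le> mass"
    unfolding eq wmass_def by (intro sum_mono length_sm_bounds)
  have "(\<Sum>b<l. length (sm b)) * s \<le> (\<Sum>b<l. hi b - lo b + s)"
    unfolding sum_distrib_right by (intro sum_mono length_sm_bounds)
  then show "(\<Sum>b\<in>leaves J 0. length (sm b)) * s \<le> mass + l * s"
    unfolding eq wmass_def by (simp add: sum.distrib)
  show "mass \<le> (\<Sum>b\<in>leaves J 0. length (sm b)) * s"
    unfolding eq wmass_def sum_distrib_right by (intro sum_mono length_sm_bounds)
qed

text \<open>Two errors add up. Thinning underestimates counts by at most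
  \<open>2 ^ J \<le> 4 * l\<close> samples, each worth \<open>s\<close> elements; sampling errs in
  each window by \<open>s\<close> upwards and \<open>2 * s\<close> downwards. This gives 4, 4 + 1
  and 2 times \<open>s * l\<close>.\<close>

lemma pivot_rank:
  fixes J r defines "L \<equiv> summ (key A) sm J 0" and "P \<equiv> 2 ^ (J div 2)"
  assumes J: "l \<le> 2 ^ J" "2 ^ J \<le> 4 * l"
  shows "mass \<le> s * (P * length L) + 4 * (s * l)"
    and "r < length L \<Longrightarrow> rank (key A (L ! r)) \<le> s * (P * r) + 5 * (s * l)"
    and "r < length L \<Longrightarrow> s * (P * r) \<le> rank (key A (L ! r)) + 2 * (s * l)"
proof -
  have cnts: "P * cnt D L \<le> (\<Sum>b\<in>leaves J 0. cnt D (sm b))"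
    "(\<Sum>b\<in>leaves J 0. cnt D (sm b)) \<le> P * cnt D L + 4 * l" if "down (key A) D" for D
    using summ_cnt[of "key A" sm D J 0, OF ssorted_sm _ that] sm_keys_disjoint J(2)
    unfolding L_def P_def by fastforce+
  have "(\<Sum>b\<in>leaves J 0. length (sm b)) \<le> P * length L + 4 * l"
    using cnts(2)[of "\<lambda>_. True"] by (simp add: down_def)
  then have "(\<Sum>b\<in>leaves J 0. length (sm b)) * s \<le> (P * length L + 4 * l) * s"
    by (rule mult_le_mono1)
  then show "mass \<le> s * (P * length L) + 4 * (s * l)"
    using sum_length_sm(3)[OF J(1)] by (simp add: algebra_simps)
  assume r: "r < length L"
  define x where "x = key A (L ! r)"
  define c where "c i = cnt (\<lambda>c. key A c < x) (sm i)" for i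
  have "cnt (\<lambda>c. key A c < x) L = r"
    using cnt_eq_index[OF ssorted_summ[of J 0, folded L_def] r] by (simp add: x_def)
  moreover have "(\<Sum>b\<in>leaves J 0. c b) = (\<Sum>b<l. c b)"
    by (rule sum_leaves[OF J(1)]) (simp add: c_def cnt_def)
  ultimately have C: "P * r \<le> (\<Sum>b<l. c b)" "(\<Sum>b<l. c b) \<le> P * r + 4 * l"
    using cnts[OF down_key[of x]] by (simp_all add: c_def)
  have "rank x \<le> (\<Sum>i<l. (c i + 1) * s)"
    unfolding wrank_def c_def by (intro sum_mono rk_cnt) auto
  also have "\<dots> = (\<Sum>b<l. c b) * s + l * s" by (simp add: sum_distrib_right sum.distrib)
  also have "\<dots> \<le> (P * r + 4 * l) * s + l * s" using C(2) by simp
  finally show "rank (key A (L ! r)) \<le> s * (P * r) + 5 * (s * l)"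
    by (simp add: x_def algebra_simps)
  have "(\<Sum>b<l. c b) * s \<le> (\<Sum>i<l. rk i x + 2 * s)"
    unfolding sum_distrib_right c_def by (intro sum_mono rk_cnt) auto
  moreover have "P * r * s \<le> (\<Sum>b<l. c b) * s" using C(1) by (rule mult_le_mono1)
  ultimately have "P * r * s \<le> (\<Sum>i<l. rk i x + 2 * s)" by (rule order_trans[rotated])
  then show "s * (P * r) \<le> rank (key A (L ! r)) + 2 * (s * l)"
    by (simp add: x_def wrank_def sum.distrib algebra_simps)
qed

section \<open>The cutting procedures\<close>

lemma sum_shift:
  assumes "i < l" "\<And>j. j < l \<Longrightarrow> g j = f j + (if j = i then s else 0)"
  shows "(\<Sum>j<l. g j) = (\<Sum>j<l. f j) + s"
proof -
  have "(\<Sum>j<l. g j) = (\<Sum>j<l. f j + (if j = i then s else 0))" using assms(2) by simp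
  then show ?thesis using assms(1) by (simp add: sum.distrib)
qed

lemma div_step: "s \<le> a \<Longrightarrow> a div s = Suc ((a - s) div s)"
  using s(1) by (simp add: le_div_geq)

text \<open>Each iteration passes to the next array or removes \<open>s\<close> elements, so the
  arrays left plus the remaining mass over \<open>s\<close> form a potential. This gives linear time
  even if one window is cut many times. The disjunction records why the cutting of a window stopped,
  which later limits the small elements still in it.\<close>

lemma cut_low_spec:
  fixes m :: memory
  assumes m: "m 0 = lo" "m 1 = hi" and c: "valid A c"
  shows "wpA cut_low_proc (\<lambda>t v' m'. t \<le> 20 + 60 * l + 60 * (mass div s) \<and>
    (\<forall>a. a \<noteq> 0 \<longrightarrow> m' a = m a) \<and> (\<forall>i\<ge>l. m' 0 i = lo i) \<and>
    (\<forall>i<l. lo i \<le> m' 0 i \<and> m' 0 i \<le> hi i \<and> (\<forall>q. lo i \<le> q \<and> q < m' 0 i \<longrightarrow> A ! i ! q < key A c) \<and>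
       (hi i \<le> m' 0 i + 2 * s \<or> key A c \<le> A ! i ! (m' 0 i + 2 * s))) \<and>
    v' 0 = (\<Sum>i<l. m' 0 i - lo i)) (frame [c, s, l]) m"
proof -
  define x where "x = key A c"
  define I where "I \<tau> v m' \<longleftrightarrow> v 0 = c \<and> v 1 = s \<and> v 2 = l \<and> v 3 \<le> l \<and>
    (\<forall>a. a \<noteq> 0 \<longrightarrow> m' a = m a) \<and> (\<forall>i. i \<ge> l \<or> v 3 < i \<longrightarrow> m' 0 i = lo i) \<and>
    (\<forall>i<l. lo i \<le> m' 0 i \<and> m' 0 i \<le> hi i \<and> (\<forall>q. lo i \<le> q \<and> q < m' 0 i \<longrightarrow> A ! i ! q < x) \<and>
       (i < v 3 \<longrightarrow> hi i \<le> m' 0 i + 2 * s \<or> x \<le> A ! i ! (m' 0 i + 2 * s))) \<and>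
    v 4 = (\<Sum>i<l. m' 0 i - lo i) \<and> \<tau> = 10 + 60 * (l - v 3) + 60 * ((mass - v 4) div s)"
    for \<tau> and v :: vars and m' :: memory
  have "wpA cut_low_loop (\<lambda>t v' m'. t \<le> 10 + 60 * l + 60 * (mass div s) \<and> v' 3 = l \<and>
      (\<exists>\<tau>. I \<tau> v' m')) (frame [c, s, l]) m"
    unfolding cut_low_loop_def
  proof (rule wp_mono, rule wp_While[where I = I and \<tau> = "10 + 60 * l + 60 * (mass div s)"], goal_cases)
    case 1
    then show ?case using m win by (auto simp: I_def frame_def)
  next
    case (2 \<tau> v m')
    define i where "i = v 3"
    define p where "p = m' 0 i"
    have v: "v 0 = c" "v 1 = s" "v 2 = l" "v 3 = i" "i < l" using 2 by (auto simp: I_def i_def)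
    have keep: "\<forall>a. a \<noteq> 0 \<longrightarrow> m' a = m a" "\<forall>j. j \<ge> l \<or> i < j \<longrightarrow> m' 0 j = lo j"
      and low: "\<And>j. j < l \<Longrightarrow> lo j \<le> m' 0 j" "\<And>j. j < l \<Longrightarrow> m' 0 j \<le> hi j"
        "\<And>j q. j < l \<Longrightarrow> lo j \<le> q \<Longrightarrow> q < m' 0 j \<Longrightarrow> A ! j ! q < x"
        "\<And>j. j < i \<Longrightarrow> hi j \<le> m' 0 j + 2 * s \<or> x \<le> A ! j ! (m' 0 j + 2 * s)"
      and v4: "v 4 = (\<Sum>j<l. m' 0 j - lo j)"
      and \<tau>: "\<tau> = 10 + 60 * (l - i) + 60 * ((mass - v 4) div s)"
      using 2 v(5) by (auto simp: I_def i_def)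
    have hin: "hi i \<le> n" using win(2)[OF v(5)] length_nth_le[OF v(5)] by linarith
    have "m' 0 i \<le> n" using hin low(2)[OF v(5)] by linarith
    then have b: "m' 0 i + (s + s) < 2 ^ w" "s + s < 2 ^ w" "m' 0 i + s < 2 ^ w"
      "Suc i < 2 ^ w" using v(5) s(2) nonempty word_n word_l by linarith+
    define hit where "hit \<longleftrightarrow> m' 0 i + 2 * s < hi i \<and> A ! i ! (m' 0 i + 2 * s) < x"
    have "m' 1 = hi" using keep m by auto
    then have test: "test w A v m' (And (Less (Add (Get 0 (Var 3)) (Add (Var 1) (Var 1))) (Get 1 (Var 3)))
                   (Elem_Less (Var 3) (Add (Get 0 (Var 3)) (Add (Var 1) (Var 1)))
                      (arr (Var 0) (Var 2)) (Div (Var 0) (Var 2)))) = hit"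
      using v b c win(2)[OF v(5)] valid_bounds(1)[OF c]
      by (auto simp: hit_def eval_arr x_def key_def valid_def mult_2)
    show ?case
    proof (cases "hit")
      case True
      define lo' where "lo' = (m' 0)(i := m' 0 i + s)"
      have lo': "(\<Sum>j<l. lo' j - lo j) = v 4 + s"
        unfolding v4 using low(1) v(5) by (intro sum_shift[of i]) (auto simp: lo'_def)
      have small: "A ! i ! q < x" if "q < m' 0 i + s" for q
      proof -
        have "A ! i ! q < A ! i ! (m' 0 i + 2 * s)"
          using True that win(2)[OF v(5)] by (intro spaced[OF v(5)]) (auto simp: hit_def)
        also have "\<dots> < x" using True by (simp add: hit_def)
        finally show ?thesis .
      qed
      have le: "lo' j \<le> hi j" if "j < l" for j
        using low(2)[OF that] True by (auto simp: lo'_def hit_def)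
      have "(\<Sum>j<l. lo' j - lo j) \<le> mass"
        unfolding wmass_def by (intro sum_mono diff_le_mono le) auto
      then have tot: "v 4 + s \<le> mass" using lo' by simp
      then have b4: "v 4 + s < 2 ^ w" using mass_le word_n nonempty by linarith
      have div: "(mass - v 4) div s = Suc ((mass - (v 4 + s)) div s)"
        using div_step[of "mass - v 4"] tot by simp
      have "I (10 + 60 * (l - i) + 60 * ((mass - (v 4 + s)) div s)) (v(4 := v 4 + s)) (m'(0 := lo'))"
        using v keep low small le lo'
        by (auto simp: I_def lo'_def intro: trans_le_add1 dest: less_imp_neq)
      then show ?thesis unfolding wp_If test if_P[OF True]
        using v b b4 \<tau> div by (auto simp: lo'_def intro!: exI)
    next
      case False
      then have "hi i \<le> m' 0 i + 2 * s \<or> x \<le> A ! i ! (m' 0 i + 2 * s)"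
        by (auto simp: hit_def)
      then have "I (10 + 60 * (l - Suc i) + 60 * ((mass - v 4) div s)) (v(3 := Suc i)) m'"
        using v keep low v4 by (auto simp: I_def less_Suc_eq)
      moreover have "l - i = Suc (l - Suc i)" using v(5) by simp
      ultimately show ?thesis unfolding wp_If test if_not_P[OF False]
        using v b \<tau> by (auto intro!: exI)
    qed
  next
    case (3 \<tau> v' m')
    then show ?case by (auto simp: I_def)
  next
    case (4 t v' m')
    then show ?case by (auto simp: I_def)
  qed
  then show ?thesis unfolding cut_low_proc_def wp_Seq wp_Assign
    by (rule wp_mono) (auto simp: I_def x_def)
qed

lemma cut_high_spec:
  fixes m :: memory
  assumes m: "m 0 = lo" "m 1 = hi" and c: "valid A c"
  shows "wpA cut_high_proc (\<lambda>t v' m'. t \<le> 20 + 60 * l + 60 * (mass div s) \<and>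
    (\<forall>a. a \<noteq> 1 \<longrightarrow> m' a = m a) \<and> (\<forall>i\<ge>l. m' 1 i = hi i) \<and>
    (\<forall>i<l. lo i \<le> m' 1 i \<and> m' 1 i \<le> hi i \<and> (\<forall>q. m' 1 i \<le> q \<and> q < hi i \<longrightarrow> key A c < A ! i ! q) \<and>
       (m' 1 i \<le> lo i + 2 * s \<or> A ! i ! (m' 1 i - (2 * s + 1)) \<le> key A c)) \<and>
    v' 0 = (\<Sum>i<l. hi i - m' 1 i)) (frame [c, s, l]) m"
proof -
  define x where "x = key A c"
  define I where "I \<tau> v m' \<longleftrightarrow> v 0 = c \<and> v 1 = s \<and> v 2 = l \<and> v 3 \<le> l \<and>
    (\<forall>a. a \<noteq> 1 \<longrightarrow> m' a = m a) \<and> (\<forall>i. i \<ge> l \<or> v 3 < i \<longrightarrow> m' 1 i = hi i) \<and>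
    (\<forall>i<l. lo i \<le> m' 1 i \<and> m' 1 i \<le> hi i \<and> (\<forall>q. m' 1 i \<le> q \<and> q < hi i \<longrightarrow> x < A ! i ! q) \<and>
       (i < v 3 \<longrightarrow> m' 1 i \<le> lo i + 2 * s \<or> A ! i ! (m' 1 i - (2 * s + 1)) \<le> x)) \<and>
    v 4 = (\<Sum>i<l. hi i - m' 1 i) \<and> \<tau> = 10 + 60 * (l - v 3) + 60 * ((mass - v 4) div s)"
    for \<tau> and v :: vars and m' :: memory
  have "wpA cut_high_loop (\<lambda>t v' m'. t \<le> 10 + 60 * l + 60 * (mass div s) \<and> v' 3 = l \<and>
      (\<exists>\<tau>. I \<tau> v' m')) (frame [c, s, l]) m"
    unfolding cut_high_loop_def
  proof (rule wp_mono, rule wp_While[where I = I and \<tau> = "10 + 60 * l + 60 * (mass div s)"], goal_cases)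
    case 1
    then show ?case using m win by (auto simp: I_def frame_def)
  next
    case (2 \<tau> v m')
    define i where "i = v 3"
    have v: "v 0 = c" "v 1 = s" "v 2 = l" "v 3 = i" "i < l" using 2 by (auto simp: I_def i_def)
    have keep: "\<forall>a. a \<noteq> 1 \<longrightarrow> m' a = m a" "\<forall>j. j \<ge> l \<or> i < j \<longrightarrow> m' 1 j = hi j"
      and high: "\<And>j. j < l \<Longrightarrow> lo j \<le> m' 1 j" "\<And>j. j < l \<Longrightarrow> m' 1 j \<le> hi j"
        "\<And>j q. j < l \<Longrightarrow> m' 1 j \<le> q \<Longrightarrow> q < hi j \<Longrightarrow> x < A ! j ! q"
        "\<And>j. j < i \<Longrightarrow> m' 1 j \<le> lo j + 2 * s \<or> A ! j ! (m' 1 j - (2 * s + 1)) \<le> x"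
      and v4: "v 4 = (\<Sum>j<l. hi j - m' 1 j)"
      and \<tau>: "\<tau> = 10 + 60 * (l - i) + 60 * ((mass - v 4) div s)"
      using 2 v(5) by (auto simp: I_def i_def)
    have hin: "hi i \<le> n" using win(2)[OF v(5)] length_nth_le[OF v(5)] by linarith
    have "lo i \<le> n" using hin win(1)[OF v(5)] by linarith
    then have b: "lo i + (s + s) < 2 ^ w" "s + s < 2 ^ w" "Suc (s + s) < 2 ^ w"
      "Suc i < 2 ^ w" using v(5) s(2) nonempty word_n word_l by linarith+
    define hit where "hit \<longleftrightarrow> lo i + 2 * s < m' 1 i \<and> x < A ! i ! (m' 1 i - (2 * s + 1))"
    have m0: "m' 0 = lo" using keep m by auto
    have "m' 1 i - Suc (2 * s) < length (A ! i)" if "lo i + 2 * s < m' 1 i"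
      using that high(2)[OF v(5)] win(2)[OF v(5)] by linarith
    then have test: "test w A v m' (And (Less (Add (Get 0 (Var 3)) (Add (Var 1) (Var 1))) (Get 1 (Var 3)))
                   (Elem_Less (arr (Var 0) (Var 2)) (Div (Var 0) (Var 2))
                      (Var 3) (Sub (Get 1 (Var 3)) (Add (Add (Var 1) (Var 1)) (Num 1))))) = hit"
      using v b c m0 valid_bounds(1)[OF c]
      by (auto simp: hit_def eval_arr x_def key_def valid_def mult_2)
    show ?case
    proof (cases "hit")
      case True
      define hi' where "hi' = (m' 1)(i := m' 1 i - s)"
      have big: "lo i + 2 * s < m' 1 i" using True by (simp add: hit_def)
      have hi': "(\<Sum>j<l. hi j - hi' j) = v 4 + s"
        unfolding v4 using high(2) v(5) big by (intro sum_shift[of i]) (auto simp: hi'_def)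
      have large: "x < A ! i ! q" if "m' 1 i - s \<le> q" "q < hi i" for q
      proof -
        have "x < A ! i ! (m' 1 i - (2 * s + 1))" using True by (simp add: hit_def)
        also have "\<dots> < A ! i ! q"
          using big that win(2)[OF v(5)] by (intro spaced[OF v(5)]) auto
        finally show ?thesis .
      qed
      have le: "lo j \<le> hi' j" if "j < l" for j
        using high(1)[OF that] big by (auto simp: hi'_def)
      have le2: "hi' j \<le> hi j" if "j < l" for j
        using high(2)[OF that] by (auto simp: hi'_def)
      have "(\<Sum>j<l. hi j - hi' j) \<le> mass"
        unfolding wmass_def by (intro sum_mono diff_le_mono2 le) auto
      then have tot: "v 4 + s \<le> mass" using hi' by simp
      then have b4: "v 4 + s < 2 ^ w" using mass_le word_n nonempty by linarith
      have div: "(mass - v 4) div s = Suc ((mass - (v 4 + s)) div s)"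
        using div_step[of "mass - v 4"] tot by simp
      have "I (10 + 60 * (l - i) + 60 * ((mass - (v 4 + s)) div s)) (v(4 := v 4 + s)) (m'(1 := hi'))"
        unfolding I_def using v keep high large le le2 hi'
        by (simp add: hi'_def)
      then show ?thesis unfolding wp_If test if_P[OF True]
        using v b b4 \<tau> div by (auto simp: hi'_def intro!: exI)
    next
      case False
      then have "m' 1 i \<le> lo i + 2 * s \<or> A ! i ! (m' 1 i - (2 * s + 1)) \<le> x"
        by (auto simp: hit_def)
      then have "I (10 + 60 * (l - Suc i) + 60 * ((mass - v 4) div s)) (v(3 := Suc i)) m'"
        using v keep high v4 by (auto simp: I_def less_Suc_eq)
      moreover have "l - i = Suc (l - Suc i)" using v(5) by simp
      ultimately show ?thesis unfolding wp_If test if_not_P[OF False]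
        using v b \<tau> by (auto intro!: exI)
    qed
  next
    case (3 \<tau> v' m')
    then show ?case by (auto simp: I_def)
  next
    case (4 t v' m')
    then show ?case by (auto simp: I_def)
  qed
  then show ?thesis unfolding cut_high_proc_def wp_Seq wp_Assign
    by (rule wp_mono) (auto simp: I_def x_def)
qed

end

section \<open>One round\<close>

lemma wrank_mono: "x \<le> y \<Longrightarrow> wrank A lo hi x \<le> wrank A lo hi y"
  unfolding wrank_def wrk_def by (intro sum_mono card_mono) auto

context windows
begin

lemma target_window:
  assumes "target A lo hi y k"
  obtains i q where "i < l" "lo i \<le> q" "q < hi i" "A ! i ! q = y"
proof -
  obtain i q where i: "i < l" "q < length (A ! i)" "A ! i ! q = y"
    using assms by (auto simp: target_def)
  then have "\<not> q < lo i" "\<not> hi i \<le> q" using assms by (auto simp: target_def)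
  with i show ?thesis by (intro that[of i q]) auto
qed

text \<open>If \<open>y\<close> were below \<open>x\<close>, then \<open>y\<close> itself would
  count towards the rank of \<open>x\<close> but not towards its own, so the rank of
  \<open>x\<close> would be at least \<open>k\<close>.\<close>

lemma le_target:
  assumes t: "target A lo hi y k" and "rank x < k"
  shows "x \<le> y"
proof (rule ccontr)
  assume "\<not> x \<le> y"
  then have yx: "y < x" by simp
  obtain i q where i: "i < l" "lo i \<le> q" "q < hi i" "A ! i ! q = y"
    using target_window[OF t] .
  have "rank y < rank x"
    unfolding wrank_def
  proof (rule sum_strict_mono_ex1)
    show "\<forall>i\<in>{..<l}. rk i y \<le> rk i x"
      unfolding wrk_def using yx by (intro ballI card_mono) auto
    have "{q. lo i \<le> q \<and> q < hi i \<and> A ! i ! q < y} \<subset> {q. lo i \<le> q \<and> q < hi i \<and> A ! i ! q < x}"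
      using i yx by auto
    then show "\<exists>i\<in>{..<l}. rk i y < rk i x"
      unfolding wrk_def using i(1) by (intro bexI[of _ i] psubset_card_mono) auto
  qed simp
  then show False using assms by (simp add: target_def)
qed

lemma target_le:
  assumes "target A lo hi y k" and "k \<le> rank x"
  shows "y \<le> x"
proof (rule ccontr)
  assume "\<not> y \<le> x"
  then have "rank x \<le> rank y" by (intro wrank_mono) auto
  then show False using assms by (simp add: target_def)
qed

text \<open>The removed elements are below \<open>x \<le> y\<close>, so the rank of \<open>y\<close>
  drops by exactly their number. Where cutting stopped, elements at least \<open>s\<close> after
  position \<open>lo' + 2 * s\<close> exceed \<open>x\<close>, so at most \<open>3 * s\<close>
  elements below \<open>x\<close> stay in a window: the progress is nearly the rank of the
  pivot.\<close>

lemma cut_low: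
  assumes t: "target A lo hi y k" and x: "rank x < k"
    and lo': "\<And>i. i < l \<Longrightarrow> lo i \<le> lo' i" "\<And>i. i < l \<Longrightarrow> lo' i \<le> hi i"
      "\<And>i q. i < l \<Longrightarrow> lo i \<le> q \<Longrightarrow> q < lo' i \<Longrightarrow> A ! i ! q < x"
    and stop: "\<And>i. i < l \<Longrightarrow> hi i \<le> lo' i + 2 * s \<or> x \<le> A ! i ! (lo' i + 2 * s)"
  defines "D \<equiv> (\<Sum>i<l. lo' i - lo i)"
  shows "target A lo' hi y (k - D)" "wmass A lo' hi = mass - D" "rank x \<le> D + 3 * (s * l)"
proof -
  have xy: "x \<le> y" using le_target[OF t x] .
  have split: "rk i y = (lo' i - lo i) + wrk A lo' hi i y" if i: "i < l" for i
  proof -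
    have "A ! i ! q < y" if "lo i \<le> q" "q < lo' i" for q
      using lo'(3)[OF i that] xy by (rule less_le_trans)
    then have "{q. lo i \<le> q \<and> q < hi i \<and> A ! i ! q < y} =
        {lo i..<lo' i} \<union> {q. lo' i \<le> q \<and> q < hi i \<and> A ! i ! q < y}"
      using lo'(1,2)[OF i] by auto
    then have "rk i y = card ({lo i..<lo' i} \<union> {q. lo' i \<le> q \<and> q < hi i \<and> A ! i ! q < y})"
      by (simp only: wrk_def)
    also have "\<dots> = card {lo i..<lo' i} + card {q. lo' i \<le> q \<and> q < hi i \<and> A ! i ! q < y}"
      by (rule card_Un_disjoint) auto
    finally show ?thesis by (simp add: wrk_def)
  qed
  have "rank y = (\<Sum>i<l. (lo' i - lo i) + wrk A lo' hi i y)"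
    unfolding wrank_def using split by (intro sum.cong) auto
  then have "rank y = D + wrank A lo' hi y"
    by (simp add: sum.distrib D_def wrank_def)
  moreover have "A ! i ! q < y" if "i < l" "q < lo' i" for i q
    using t that lo'(3)[of i q] xy by (cases "q < lo i") (auto simp: target_def)
  ultimately show "target A lo' hi y (k - D)" using t by (auto simp: target_def)
  have "mass = (\<Sum>i<l. (lo' i - lo i) + (hi i - lo' i))"
    unfolding wmass_def using lo'(1,2) by (intro sum.cong) auto
  then show "wmass A lo' hi = mass - D" by (simp add: sum.distrib D_def wmass_def)
  have "rk i x \<le> (lo' i - lo i) + 3 * s" if i: "i < l" for i
  proof -
    have "{q. lo i \<le> q \<and> q < hi i \<and> A ! i ! q < x} \<subseteq> {lo i..<lo' i + 3 * s}"
    proof safe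
      fix q assume q: "lo i \<le> q" "q < hi i" "A ! i ! q < x"
      show "q \<in> {lo i..<lo' i + 3 * s}"
      proof (rule ccontr)
        assume "q \<notin> {lo i..<lo' i + 3 * s}"
        then have ge: "lo' i + 2 * s + s \<le> q" using q by auto
        then have "A ! i ! (lo' i + 2 * s) < A ! i ! q"
          using q win(2)[OF i] by (intro spaced[OF i]) auto
        then show False using stop[OF i] q ge by auto
      qed
    qed
    from card_mono[OF _ this] show ?thesis using lo'(1)[OF i] by (simp add: wrk_def)
  qed
  then have "rank x \<le> (\<Sum>i<l. (lo' i - lo i) + 3 * s)"
    unfolding wrank_def by (intro sum_mono) auto
  then show "rank x \<le> D + 3 * (s * l)" by (simp add: sum.distrib D_def algebra_simps)
qed

text \<open>Only elements above \<open>y\<close> go, so its rank stays. Where cutting stopped,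
  elements more than \<open>3 * s\<close> before the new end are below \<open>x\<close>; the
  elements below \<open>x\<close>, the removed ones and \<open>3 * s\<close> per window therefore
  account for the whole mass.\<close>

lemma cut_high:
  assumes t: "target A lo hi y k" and x: "k \<le> rank x"
    and hi': "\<And>i. i < l \<Longrightarrow> lo i \<le> hi' i" "\<And>i. i < l \<Longrightarrow> hi' i \<le> hi i"
      "\<And>i q. i < l \<Longrightarrow> hi' i \<le> q \<Longrightarrow> q < hi i \<Longrightarrow> x < A ! i ! q"
    and stop: "\<And>i. i < l \<Longrightarrow> hi' i \<le> lo i + 2 * s \<or> A ! i ! (hi' i - (2 * s + 1)) \<le> x"
  defines "D \<equiv> (\<Sum>i<l. hi i - hi' i)"
  shows "target A lo hi' y k" "wmass A lo hi' = mass - D" "mass \<le> rank x + D + 3 * (s * l)"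
proof -
  have yx: "y \<le> x" using target_le[OF t x] .
  have gt: "y < A ! i ! q" if "i < l" "hi' i \<le> q" "q < hi i" for i q
    using hi'(3)[OF that] yx by order
  have "{q. lo i \<le> q \<and> q < hi i \<and> A ! i ! q < y} = {q. lo i \<le> q \<and> q < hi' i \<and> A ! i ! q < y}"
    if i: "i < l" for i
    using gt[OF i] hi'(2)[OF i] by (auto dest: less_le_trans) (meson not_le order.asym)
  then have "rank y = wrank A lo hi' y"
    unfolding wrank_def wrk_def by (intro sum.cong) auto
  moreover have "y < A ! i ! q" if "i < l" "hi' i \<le> q" "q < length (A ! i)" for i q
    using t that gt[of i q] by (cases "hi i \<le> q") (auto simp: target_def)
  ultimately show "target A lo hi' y k" using t by (auto simp: target_def)
  have "mass = (\<Sum>i<l. (hi i - hi' i) + (hi' i - lo i))"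
    unfolding wmass_def using hi'(1,2) by (intro sum.cong) auto
  then show "wmass A lo hi' = mass - D" by (simp add: sum.distrib D_def wmass_def)
  have "hi i - lo i \<le> rk i x + ((hi i - hi' i) + 3 * s)" if i: "i < l" for i
  proof -
    have "{lo i..<hi' i - 3 * s} \<subseteq> {q. lo i \<le> q \<and> q < hi i \<and> A ! i ! q < x}"
    proof safe
      fix q assume q: "q \<in> {lo i..<hi' i - 3 * s}"
      then have "A ! i ! q < A ! i ! (hi' i - (2 * s + 1))"
        using hi'(2)[OF i] win(2)[OF i] by (intro spaced[OF i]) auto
      then show "A ! i ! q < x" using stop[OF i] q by auto
      show "lo i \<le> q" "q < hi i" using q hi'(2)[OF i] by auto
    qed
    from card_mono[OF _ this] have "hi' i - 3 * s - lo i \<le> rk i x" by (simp add: wrk_def)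
    then show ?thesis using hi'(2)[OF i] by linarith
  qed
  then have "mass \<le> (\<Sum>i<l. rk i x + ((hi i - hi' i) + 3 * s))"
    unfolding wmass_def by (intro sum_mono) auto
  then show "mass \<le> rank x + D + 3 * (s * l)"
    by (simp add: sum.distrib D_def wrank_def algebra_simps)
qed

end

text \<open>In the following estimate \<open>E\<close> is \<open>s * l\<close>, the unit of all rounding errors, \<open>W\<close> is the
weight \<open>s * P\<close> of an element of the summary, and \<open>r\<close> is the index of the pivot.\<close>

lemma pivot_index:
  fixes N :: nat
  assumes "64 * E \<le> N" "1 \<le> W" "W \<le> 4 * E" "r = Y div W"
  shows "W * r \<le> Y" "Y \<le> W * r + 4 * E"
proof -
  have "W * r + Y mod W = Y" using assms(4) by simp
  moreover have "Y mod W < W" using assms(2) by simp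
  ultimately show "W * r \<le> Y" "Y \<le> W * r + 4 * E" using assms(3) by linarith+
qed

context windows
begin

lemma round_spec:
  fixes v :: vars and m :: memory
  assumes t: "target A lo hi y k" and s_def: "s = mass div (64 * l)"
    and J: "l \<le> 2 ^ J" "2 ^ J \<le> 4 * l" and P: "P = 2 ^ (J div 2)"
    and v: "v 0 = l" "v 2 = k" "v 3 = mass" "v 4 = J" "v 5 = P"
    and m: "m 0 = lo" "m 1 = hi"
  shows "wpA round_com (\<lambda>t v' m'. t \<le> 110000 * l \<and> v' 0 = l \<and> v' 4 = J \<and> v' 5 = P \<and> v' 6 = v 6 \<and>
    wins A (m' 0) (m' 1) \<and> target A (m' 0) (m' 1) y (v' 2) \<and>
    v' 3 = wmass A (m' 0) (m' 1) \<and> 16 * v' 3 \<le> 15 * v 3) v m"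
proof -
  define L where "L = summ (key A) sm J 0"
  define N where "N = mass"
  define E where "E = s * l"
  have "64 * l * (N div (64 * l)) \<le> N" by (rule times_div_less_eq_dividend)
  then have EN: "64 * E \<le> N" using s_def by (simp add: E_def N_def algebra_simps)
  have E1: "1 \<le> E" using s l_pos by (simp add: E_def)
  \<comment> \<open>Since \<open>s \<ge> 1\<close>, rounding down in \<open>s\<close> costs at most
    a factor 2, which makes \<open>N / s\<close> linear in \<open>l\<close>.\<close>
  have "N < 64 * l + 64 * l * (N div (64 * l))"
    by (rule dividend_less_times_div) (use l_pos in linarith)
  then have "N < 64 * l * Suc s" by (simp add: s_def N_def)
  also have "\<dots> \<le> 64 * l * (2 * s)" using s(1) by (intro mult_le_mono2) simp
  finally have NE: "N \<le> 128 * E" by (simp add: E_def algebra_simps)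
  have "N div s \<le> 128 * l * s div s" using NE by (intro div_le_mono) (simp add: E_def algebra_simps)
  then have Ns: "N div s \<le> 128 * l" using s(1) by simp
  have P1: "1 \<le> P" by (simp add: P)
  have "P \<le> 2 ^ J" unfolding P by (intro power_increasing) auto
  then have W: "1 \<le> s * P" "s * P \<le> 4 * E"
    using s(1) P1 J(2) mult_le_mono2[of P "4 * l" s] by (auto simp: E_def algebra_simps)
  have "(\<Sum>b\<in>leaves J 0. length (sm b)) * s \<le> (129 * l) * s"
  proof -
    have "129 * l * s = 128 * E + l * s" by (simp add: E_def algebra_simps)
    then show ?thesis using sum_length_sm(2)[OF J(1), folded N_def] NE by linarith
  qed
  then have len: "(\<Sum>b\<in>leaves J 0. length (sm b)) \<le> 129 * l" using s(1) by simp
  \<comment> \<open>The numbers are \<open>300 * 4 + 750 * 129 = 97950\<close>.\<close>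
  have cost: "scost (key A) sm J 0 \<le> 98000 * l"
  proof -
    have "scost (key A) sm J 0 \<le> 300 * 2 ^ J + 750 * (\<Sum>b\<in>leaves J 0. length (sm b))"
      by (rule scost_bound[OF ssorted_sm]) (rule sm_keys_disjoint)
    then show ?thesis using len J(2) by linarith
  qed
  have Nn: "N \<le> n" using mass_le by (simp add: N_def)
  have kn: "k \<le> n + 1"
  proof -
    have "rk i y \<le> hi i - lo i" for i
    proof -
      have "rk i y \<le> card {lo i..<hi i}" unfolding wrk_def by (rule card_mono) auto
      then show ?thesis by simp
    qed
    then have "rank y \<le> N" unfolding wrank_def wmass_def N_def by (rule sum_mono)
    then show ?thesis using t Nn by (simp add: target_def)
  qed
  have piv: "N \<le> s * P * length L + 4 * E"
    "\<And>r. r < length L \<Longrightarrow> rank (key A (L ! r)) \<le> s * P * r + 5 * E"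
    "\<And>r. r < length L \<Longrightarrow> s * P * r \<le> rank (key A (L ! r)) + 2 * E"
    using pivot_rank[OF J, folded L_def P] by (simp_all add: N_def E_def mult.assoc)
  \<comment> \<open>The final list represents all but \<open>4 * E\<close> of the elements, so it
    cannot end before a weight that stays below this.\<close>
  have index: "r < length L" if "s * P * r \<le> Y" "Y + 4 * E < N" for r Y
  proof (rule ccontr)
    assume "\<not> r < length L"
    then have "s * P * length L \<le> s * P * r" by (intro mult_le_mono2) auto
    then show False using that piv(1) by linarith
  qed
  define rl where "rl = N div 4 div (s * P)"
  define rh where "rh = (N - N div 4) div (s * P)"
  note il = pivot_index[OF EN W rl_def] and ih = pivot_index[OF EN W rh_def]
  have rl: "rl < length L" by (rule index[OF il(1)]) (use EN E1 in linarith)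
  have rh: "rh < length L" by (rule index[OF ih(1)]) (use EN E1 in linarith)
  have valid: "valid A (L ! r)" if "r < length L" for r
    using valid_summ[of "L ! r" J 0] that by (simp add: L_def)
  have low: "wpA cut_low_proc (\<lambda>t v' m'. t \<le> 8000 * l \<and> wins A (m' 0) (m' 1) \<and>
      target A (m' 0) (m' 1) y (k - v' 0) \<and> wmass A (m' 0) (m' 1) = N - v' 0 \<and> N \<le> 16 * v' 0)
      (frame [L ! rl, s, l]) m1"
    if m1: "m1 0 = lo" "m1 1 = hi" and k: "N < 2 * k" for m1
  proof (rule wp_mono[OF cut_low_spec[OF m1 valid[OF rl]]], elim conjE, goal_cases)
    case (1 t' v' m')
    let ?x = "key A (L ! rl)"
    \<comment> \<open>The rank is at most \<open>N / 4 + 5 * E \<le> 21 * N / 64\<close>, while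
      \<open>k > N / 2\<close>.\<close>
    have "rank ?x < k" using piv(2)[OF rl] il EN E1 k by linarith
    note cut = cut_low[OF t this, of "m' 0"]
    have hi: "m' 1 = hi" using 1 m1 by auto
    have "target A (m' 0) hi y (k - v' 0)" "wmass A (m' 0) hi = mass - v' 0"
      and rk: "rank ?x \<le> v' 0 + 3 * (s * l)"
      unfolding 1(5) by (rule cut; use 1 in simp)+
    moreover have "wins A (m' 0) hi" using 1 win out by (auto simp: wins_def)
    moreover have "t' \<le> 8000 * l" using 1(1) Ns l_pos by (simp add: N_def)
    \<comment> \<open>From \<open>N div 4\<close> the index rounding takes \<open>4 * E\<close>, the
      rank estimate \<open>2 * E\<close> and the cut \<open>3 * E\<close>; about
      \<open>7 * N / 64\<close> remains.\<close>
    moreover have "N \<le> 16 * v' 0" using piv(3)[OF rl] il EN E1 rk[folded E_def] by linarith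
    ultimately show ?case unfolding hi N_def by blast
  qed
  have high: "wpA cut_high_proc (\<lambda>t v' m'. t \<le> 8000 * l \<and> wins A (m' 0) (m' 1) \<and>
      target A (m' 0) (m' 1) y k \<and> wmass A (m' 0) (m' 1) = N - v' 0 \<and> N \<le> 16 * v' 0)
      (frame [L ! rh, s, l]) m1"
    if m1: "m1 0 = lo" "m1 1 = hi" and k: "\<not> N < 2 * k" for m1
  proof (rule wp_mono[OF cut_high_spec[OF m1 valid[OF rh]]], elim conjE, goal_cases)
    case (1 t' v' m')
    let ?x = "key A (L ! rh)"
    \<comment> \<open>The rank is at least \<open>3 * N / 4 - 6 * E \<ge> 42 * N / 64\<close>, while
      \<open>k \<le> N / 2\<close>.\<close>
    have "k \<le> rank ?x" using piv(3)[OF rh] ih EN E1 k by linarith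
    note cut = cut_high[OF t this, of "m' 1"]
    have lo: "m' 0 = lo" using 1 m1 by auto
    have "target A lo (m' 1) y k" "wmass A lo (m' 1) = mass - v' 0"
      and rk: "mass \<le> rank ?x + v' 0 + 3 * (s * l)"
      unfolding 1(5) by (rule cut; use 1 in simp)+
    moreover have "m' 1 i \<le> length (A ! i)" if "i < l" for i
    proof -
      have "m' 1 i \<le> hi i" using 1(4) that by blast
      then show ?thesis using win(2)[OF that] by linarith
    qed
    then have "wins A lo (m' 1)" using 1(3,4) out by (simp add: wins_def)
    moreover have "t' \<le> 8000 * l" using 1(1) Ns l_pos by (simp add: N_def)
    \<comment> \<open>Here \<open>5 * E\<close> for the rank and \<open>3 * E\<close> for the cut
      are lost from \<open>N div 4\<close>.\<close>
    moreover have "N \<le> 16 * v' 0"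
      using piv(2)[OF rh] ih EN E1 rk[folded E_def N_def] by linarith
    ultimately show ?case unfolding lo N_def by blast
  qed
  have b: "64 * l < 2 ^ w" "s * P < 2 ^ w" "k + k < 2 ^ w"
    using word_l word_n kn nonempty l_pos W(2) EN Nn by linarith+
  have sd: "N div (64 * l) = s" using s_def by (simp add: N_def)
  have "2 ^ J < (2::nat) ^ w" "0 + (\<Sum>b\<in>leaves J 0. length (sm b)) < 2 ^ w"
    using J(2) word_l l_pos word_n nonempty Nn sum_length_sm(1)[OF J(1)] unfolding N_def by linarith+
  then have summ: "wpA summ_proc (\<lambda>t v' m'. t \<le> 98000 * l \<and>
      m' 0 = lo \<and> m' 1 = hi \<and> map (m' 2) [0..<length L] = L) (frame [J, 0, 0, s, l]) m"
    by (intro wp_mono[OF summ_spec[OF m, of 0 J 0, folded L_def]]) (use cost in auto)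
  have nth: "m1 2 r = L ! r" if "map (m1 2) [0..<length L] = L" "r < length L" for m1 :: memory and r
    using arg_cong[OF that(1), of "\<lambda>xs. xs ! r"] that(2) by simp
  show ?thesis
    unfolding round_com_def
    apply (simp add: v b sd N_def[symmetric])
    apply (rule wp_mono[OF summ])
    apply (elim conjE)
    apply (simp add: b rl_def[symmetric] rh_def[symmetric] nth rl rh)
    apply (intro conjI impI)
    subgoal
      apply (rule wp_mono[OF low])
      using l_pos by (auto simp: v)
    subgoal
      apply (rule wp_mono[OF high])
      using l_pos by (auto simp: v)
    done
qed

end

section \<open>The main loop\<close>

text \<open>Eleven rounds halve the mass, because \<open>(15 / 16) ^ 11 < 1 / 2\<close>;
  \<open>max N l\<close> keeps the logarithm nonnegative.\<close>

definition iters :: "nat \<Rightarrow> nat \<Rightarrow> nat" where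
  "iters l N = nat \<lceil>11 * log 2 (real (max N l) / real l)\<rceil>"

text \<open>The hypothesis \<open>64 * l < N\<close> handles the maximum: even if \<open>N'\<close>
  falls below \<open>l\<close>, the argument of the logarithm shrinks by the factor 15/16.\<close>

lemma iters_step:
  assumes l: "1 \<le> l" and N: "64 * l < N" and N': "16 * N' \<le> 15 * N"
  shows "Suc (iters l N') \<le> iters l N"
proof -
  define a where "a = log 2 (real (max N l) / real l)"
  define b where "b = log 2 (real (max N' l) / real l)"
  have "real (max N' l) \<le> 15 / 16 * real N" using N N' by linarith
  then have "real (max N' l) / real l \<le> 15 / 16 * (real (max N l) / real l)"
    using l N divide_right_mono[of "real (max N' l)" "15 / 16 * real N" "real l"] by simp
  then have "b \<le> log 2 (15 / 16 * (real (max N l) / real l))"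
    unfolding b_def using l by simp
  also have "\<dots> = log 2 (15 / 16) + a"
    unfolding a_def using l by (subst log_mult) auto
  finally have "11 * b \<le> 11 * log 2 (15 / 16) + 11 * a" by simp
  also have "11 * log 2 (15 / 16) = log 2 ((15 / 16) ^ 11)"
    by (simp add: log_nat_power)
  also have "\<dots> \<le> log 2 (1 / 2)" by (subst log_le_cancel_iff) (auto simp: power_divide)
  also have "log 2 (1 / 2) = - (1 :: real)" by (simp add: log_divide)
  finally have ab: "11 * b + 1 \<le> 11 * a" by simp
  have "0 \<le> b" unfolding b_def using l by simp
  then have "0 \<le> \<lceil>11 * b\<rceil>" by (simp add: le_ceiling_iff)
  moreover have "\<lceil>11 * b\<rceil> + 1 \<le> \<lceil>11 * a\<rceil>" using ab by linarith
  ultimately show ?thesis unfolding iters_def a_def[symmetric] b_def[symmetric] by linarith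
qed

text \<open>Rounding up costs one unit beyond 11, and \<open>max 1\<close> absorbs it.\<close>

lemma iters_bound:
  assumes "1 \<le> l"
  shows "real (iters l N) \<le> 12 * max 1 (log 2 (real N / real l))"
proof -
  define a where "a = log 2 (real (max N l) / real l)"
  have "0 \<le> a" unfolding a_def using assms by simp
  then have "real (iters l N) \<le> 11 * a + 1" unfolding iters_def a_def[symmetric] by linarith
  moreover have "a \<le> max 1 (log 2 (real N / real l))"
    unfolding a_def using assms by (cases "N \<le> l") (auto simp: max_def)
  ultimately show ?thesis by linarith
qed

context machine
begin

section \<open>The loops of the main command\<close>

lemma init_loop:
  assumes v: "v 0 = l" "v 3 = 0" "v 4 = 0"
  shows "wpA init_loop (\<lambda>t v' m'. t \<le> 10 + 30 * l \<and> v' 0 = l \<and> v' 1 = v 1 \<and> v' 2 = v 2 \<and> v' 3 = n \<and>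
    m' 0 = (\<lambda>_. 0) \<and> m' 1 = (\<lambda>i. if i < l then length (A ! i) else 0)) v (\<lambda>_ _. 0)"
proof -
  define I where "I \<tau> v' m' \<longleftrightarrow> v' 0 = l \<and> v' 1 = v 1 \<and> v' 2 = v 2 \<and> v' 4 \<le> l \<and>
    v' 3 = (\<Sum>i<v' 4. length (A ! i)) \<and> m' 0 = (\<lambda>_. 0) \<and>
    m' 1 = (\<lambda>i. if i < v' 4 then length (A ! i) else 0) \<and> \<tau> = 10 + 30 * (l - v' 4)"
    for \<tau> and v' :: vars and m' :: memory
  have n: "n = (\<Sum>i<l. length (A ! i))" by (simp add: sum_list_sum_nth lessThan_atLeast0)
  show ?thesis unfolding init_loop_def
  proof (rule wp_mono, rule wp_While[where I = I and \<tau> = "10 + 30 * l"], goal_cases)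
    case 1
    then show ?case using v by (auto simp: I_def)
  next
    case (2 \<tau> v' m')
    define i where "i = v' 4"
    have i: "i < l" using 2 by (auto simp: I_def i_def)
    have "(\<Sum>j<Suc i. length (A ! j)) \<le> n" unfolding n using i by (intro sum_mono2) auto
    then have b: "(\<Sum>j<i. length (A ! j)) + length (A ! i) < 2 ^ w"
      using word_n nonempty by simp
    have b2: "Suc i < 2 ^ w" using i word_l by linarith
    have "I (10 + 30 * (l - Suc i)) (v'(3 := (\<Sum>j<i. length (A ! j)) + length (A ! i), 4 := Suc i))
      (m'(1 := (m' 1)(i := length (A ! i))))"
      using 2(1) i by (auto simp: I_def i_def)
    moreover have "l - i = Suc (l - Suc i)" using i by simp
    moreover have "v' 3 = (\<Sum>j<i. length (A ! j))" "v' 4 = i" "\<tau> = 10 + 30 * (l - i)"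
      using 2(1) by (auto simp: I_def i_def)
    ultimately show ?case using i b b2 by (auto intro!: exI)
  next
    case (3 \<tau> v' m')
    then show ?case by (auto simp: I_def)
  next
    case (4 t v' m')
    then have "v' 4 = l" by (auto simp: I_def)
    then show ?case using 4 n by (auto simp: I_def)
  qed
qed

lemma level_loop:
  assumes v: "v 0 = l" "v 4 = 0" "v 5 = 1"
  shows "wpA level_loop (\<lambda>t v' m'. t \<le> 10 + 30 * l \<and> (\<forall>i. i \<noteq> 4 \<and> i \<noteq> 5 \<longrightarrow> v' i = v i) \<and>
    m' = m \<and> v' 5 = 2 ^ (v' 4 div 2) \<and> l \<le> 2 ^ v' 4 \<and> 2 ^ v' 4 \<le> 4 * l) v m"
proof -
  define I where "I \<tau> v' m' \<longleftrightarrow> (\<forall>i. i \<noteq> 4 \<and> i \<noteq> 5 \<longrightarrow> v' i = v i) \<and> m' = m \<and> even (v' 4) \<and>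
    v' 5 = 2 ^ (v' 4 div 2) \<and> v' 5 * v' 5 \<le> 4 * l \<and> \<tau> = 10 + 30 * (l + 1 - v' 5)"
    for \<tau> and v' :: vars and m' :: memory
  have less: "x * x < 2 ^ w" if "x * x \<le> 4 * l" for x
    using that word_l l_pos by linarith
  show ?thesis unfolding level_loop_def
  proof (rule wp_mono, rule wp_While[where I = I and \<tau> = "10 + 30 * l"], goal_cases)
    case 1
    then show ?case using v l_pos by (simp add: I_def)
  next
    case (2 \<tau> v' m')
    define P where "P = v' 5"
    have I: "\<forall>i. i \<noteq> 4 \<and> i \<noteq> 5 \<longrightarrow> v' i = v i" "m' = m" "even (v' 4)" "P = 2 ^ (v' 4 div 2)"
      "P * P \<le> 4 * l" "\<tau> = 10 + 30 * (l + 1 - P)" "v' 5 = P"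
      using 2(1) by (auto simp: I_def P_def)
    have lt: "P * P < l" using 2(2) I v less[of P] by simp
    have P1: "1 \<le> P" using I(4) by simp
    then have "P \<le> P * P" by (cases P) auto
    then have Pl: "P < l" using lt by (rule le_less_trans)
    have "v' 4 < 2 ^ v' 4" by (rule less_exp)
    also have "2 ^ v' 4 = P * P"
      using I(3) unfolding I(4) by (auto elim!: evenE simp flip: power_add mult_2)
    finally have b: "v' 4 + 2 < 2 ^ w" "P + P < 2 ^ w" using lt Pl word_l by linarith+
    have "I (10 + 30 * (l + 1 - (P + P))) (v'(5 := P + P, 4 := v' 4 + 2)) m'"
      using I lt by (auto simp: I_def algebra_simps)
    moreover have "(l + 1 - (P + P)) + 1 \<le> l + 1 - P" using P1 Pl by linarith
    ultimately show ?case using I b by (auto intro!: exI)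
  next
    case (3 \<tau> v' m')
    then show ?case by (auto simp: I_def)
  next
    case (4 t v' m')
    then obtain \<tau> where I: "I \<tau> v' m'" and t: "t \<le> 10 + 30 * l" and ex: "\<not> test w A v' m' (Less (Mul (Var 5) (Var 5)) (Var 0))"
      by auto
    have "2 ^ v' 4 = v' 5 * v' 5"
      using I by (auto simp: I_def elim!: evenE simp flip: power_add mult_2)
    moreover have "l \<le> v' 5 * v' 5" using ex I v less[of "v' 5"] by (auto simp: I_def)
    ultimately show ?case using I t by (auto simp: I_def)
  qed
qed

lemma round_loop:
  fixes v :: vars and m :: memory
  assumes dist: "distinct (concat A)"
    and spaced: "\<And>i p q. i < l \<Longrightarrow> p + Suc g \<le> q \<Longrightarrow> q < length (A ! i) \<Longrightarrow> A ! i ! p < A ! i ! q"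
    and J: "l \<le> 2 ^ J" "2 ^ J \<le> 4 * l" and P: "P = 2 ^ (J div 2)"
    and v: "v 0 = l" "v 3 = wmass A (m 0) (m 1)" "v 4 = J" "v 5 = P" "v 6 = 64 * l * Suc g"
    and wins: "wins A (m 0) (m 1)" and target: "target A (m 0) (m 1) y (v 2)"
  shows "wpA round_loop (\<lambda>t v' m'. t \<le> 110010 * l * iters l (v 3) + 10 \<and>
    wins A (m' 0) (m' 1) \<and> target A (m' 0) (m' 1) y (v' 2) \<and>
    wmass A (m' 0) (m' 1) \<le> 64 * l * Suc g) v m"
proof -
  define I where "I \<tau> v' m' \<longleftrightarrow> v' 0 = l \<and> v' 3 = wmass A (m' 0) (m' 1) \<and> v' 4 = J \<and> v' 5 = P \<and>
    v' 6 = 64 * l * Suc g \<and> wins A (m' 0) (m' 1) \<and> target A (m' 0) (m' 1) y (v' 2) \<and>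
    \<tau> = 110010 * l * iters l (v' 3) + 10" for \<tau> and v' :: vars and m' :: memory
  show ?thesis unfolding round_loop_def
  proof (rule wp_mono, rule wp_While[where I = I and \<tau> = "110010 * l * iters l (v 3) + 10"], goal_cases)
    case 1
    then show ?case using assms by (auto simp: I_def)
  next
    case (2 \<tau> v' m')
    define s where "s = wmass A (m' 0) (m' 1) div (64 * l)"
    have I: "v' 0 = l" "v' 3 = wmass A (m' 0) (m' 1)" "v' 4 = J" "v' 5 = P" "v' 6 = 64 * l * Suc g"
      "wins A (m' 0) (m' 1)" "target A (m' 0) (m' 1) y (v' 2)" "\<tau> = 110010 * l * iters l (v' 3) + 10"
      using 2(1) by (auto simp: I_def)
    have gt: "64 * l * Suc g < v' 3" using 2(2) I by simp
    have "Suc g * (64 * l) \<le> v' 3" using gt by (simp add: mult.commute)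
    from div_le_mono[OF this, of "64 * l"]
    have "Suc g * (64 * l) div (64 * l) \<le> s" by (simp only: s_def I(2))
    moreover have "Suc g * (64 * l) div (64 * l) = Suc g"
      by (rule nonzero_mult_div_cancel_right) (use l_pos in linarith)
    ultimately have sg: "Suc g \<le> s" by simp
    have "wmass A (m' 0) (m' 1) \<le> (\<Sum>i<l. length (A ! i))"
      unfolding wmass_def using I(6) by (intro sum_mono) (auto simp: wins_def intro: le_trans[OF diff_le_self])
    then have sn: "s \<le> n" unfolding s_def
      by (simp add: sum_list_sum_nth lessThan_atLeast0) (meson div_le_dividend le_trans)
    \<comment> \<open>While the loop runs, the mass exceeds \<open>64 * l * Suc g\<close>, hence
      \<open>Suc g \<le> s\<close>; the fixed spacing therefore implies the spacing at this round's
      distance.\<close>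
    interpret windows A w "m' 0" "m' 1" s
      by unfold_locales (use dist I(6) sg sn in \<open>auto simp: wins_def intro: spaced\<close>)
    have "l * 64 \<le> 64 * l * Suc g" by simp
    then have l64: "64 * l < v' 3" using gt by linarith
    show ?case
    proof (rule wp_mono[OF round_spec[OF I(7) s_def J P I(1) refl I(2,3,4) refl refl]], goal_cases)
      case (1 t v'' m'')
      have "Suc (iters l (v'' 3)) \<le> iters l (v' 3)"
        using 1 by (intro iters_step[OF l_pos l64]) auto
      then have "110010 * l * Suc (iters l (v'' 3)) \<le> 110010 * l * iters l (v' 3)"
        by (rule mult_le_mono2)
      moreover have "I (110010 * l * iters l (v'' 3) + 10) v'' m''" using 1 I by (simp add: I_def)
      moreover have "t \<le> 110000 * l" using 1 by blast
      ultimately show ?case using l_pos I(8)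
        by (intro exI[of _ "110010 * l * iters l (v'' 3) + 10"]) (simp add: algebra_simps)
    qed
  next
    case (3 \<tau> v' m')
    then show ?case by (auto simp: I_def)
  next
    case (4 t v' m')
    then show ?case by (auto simp: I_def)
  qed
qed

lemma main_spec:
  assumes dist: "distinct (concat A)"
    and spaced: "\<And>i p q. i < l \<Longrightarrow> p + Suc (n div u) \<le> q \<Longrightarrow> q < length (A ! i) \<Longrightarrow>
      A ! i ! p < A ! i ! q"
    and target: "target A (\<lambda>_. 0) (\<lambda>i. if i < l then length (A ! i) else 0) y k"
  shows "wpA main_com (\<lambda>t v' m'. t \<le> 110010 * l * iters l n + 200 * l \<and>
    wins A (m' 0) (m' 1) \<and> target A (m' 0) (m' 1) y (v' 0) \<and>
    wmass A (m' 0) (m' 1) \<le> 64 * l * Suc (n div u))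
    ((\<lambda>_. 0)(0 := l, 1 := u, 2 := k)) (\<lambda>_ _. 0)"
proof -
  have n: "n = (\<Sum>i<l. length (A ! i))" by (simp add: sum_list_sum_nth lessThan_atLeast0)
  have "n div u \<le> n" by simp
  then have "64 * l * Suc (n div u) \<le> 64 * l * (2 * n)" using nonempty by (intro mult_le_mono2) linarith
  then have b: "64 * l * Suc (n div u) < 2 ^ w" using word_ge(2) l_pos nonempty by (simp add: algebra_simps)
  then have b3: "64 * l + 64 * l * (n div u) < 2 ^ w" by simp
  have wm: "wmass A (\<lambda>_. 0) (\<lambda>i. if i < l then length (A ! i) else 0) = n"
    by (simp add: wmass_def n)
  have b2: "64 * l < 2 ^ w" "Suc (n div u) < 2 ^ w"
    using word_l word_n l_pos nonempty \<open>n div u \<le> n\<close> by linarith+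
  show ?thesis
    unfolding main_com_def wp_Seq
    apply (rule wp_mono, rule init_loop)
       apply simp_all[3]
    apply (elim conjE)
    apply (simp add: b2 b3)
    apply (rule wp_mono, rule level_loop)
       apply simp_all[3]
    apply (elim conjE)
    subgoal premises prems for t1 v1 m1 t2 v2 m2
      apply (rule wp_mono)
       apply (rule round_loop[where g = "n div u" and y = y and J = "v2 4" and P = "v2 5", OF dist])
                 apply (erule (2) spaced)
      using prems target l_pos apply (auto simp: wins_def wm b3)
    done
    done
qed

end

text \<open>One distance, computed from the total size, serves all arrays: by
  \<open>length X \<le> n\<close> it exceeds the gap allowed in each of them.\<close>

lemma u_sorted_spaced:
  assumes us: "u_sorted u X" and u: "1 \<le> u" and len: "length X \<le> n"
    and pq: "p + Suc (n div u) \<le> q" "q < length X"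
  shows "X ! p < X ! q"
proof -
  from us obtain ps where X: "distinct X" and ps: "\<forall>a\<in>set ps. a < length X"
    and sep: "\<forall>a\<in>set ps. \<forall>b<length X. (X ! b < X ! a \<longrightarrow> b < a) \<and> (X ! a < X ! b \<longrightarrow> a < b)"
    and gap: "\<And>j. Suc j < length (0 # ps @ [length X - 1]) \<Longrightarrow>
      real ((0 # ps @ [length X - 1]) ! Suc j) - real ((0 # ps @ [length X - 1]) ! j)
        \<le> real (length X) / real u"
    unfolding u_sorted_def Let_def by blast
  define qs where "qs = 0 # ps @ [length X - 1]"
  have "n < (q - p) * u"
  proof -
    have "n < Suc (n div u) * u" using u dividend_less_div_times[of u n] by simp
    also have "\<dots> \<le> (q - p) * u" using pq by (intro mult_le_mono1) simp
    finally show ?thesis .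
  qed
  then have "length X < (q - p) * u" using len by linarith
  then have "real (length X) < real ((q - p) * u)" by (simp only: of_nat_less_iff)
  then have "real (length X) < real (q - p) * real u" by (simp only: of_nat_mult)
  then have far: "real (length X) / real u < real q - real p"
    using u pq(1) by (simp add: divide_less_eq of_nat_diff)
  have "\<exists>a\<in>set ps. p \<le> a \<and> a \<le> q"
  proof (rule ccontr)
    assume none: "\<not> ?thesis"
    \<comment> \<open>The sequence \<open>qs\<close> starts at 0 and its steps are shorter than
      \<open>q - p\<close>. With no list position from \<open>p\<close> to \<open>q\<close> it could
      never get past \<open>p\<close>, although it ends at
      \<open>length X - 1 \<ge> q\<close>.\<close>
    have "qs ! j \<le> p" if "j < length qs" for j
      using that
    proof (induction j)
      case (Suc j)
      show ?case
      proof (rule ccontr)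
        assume gt: "\<not> qs ! Suc j \<le> p"
        have "qs ! Suc j \<in> set (ps @ [length X - 1])"
          using Suc.prems unfolding qs_def by (metis Suc_less_eq length_Cons nth_Cons_Suc nth_mem)
        then have "q \<le> qs ! Suc j" using none gt pq(2) by auto
        moreover have "qs ! j \<le> p" using Suc by simp
        moreover have "real (qs ! Suc j) - real (qs ! j) \<le> real (length X) / real u"
          using gap[of j] Suc.prems by (simp only: qs_def)
        ultimately show False using far by linarith
      qed
    qed (simp add: qs_def)
    from this[of "length qs - 1"] have "length X - 1 \<le> p" by (simp add: qs_def nth_append)
    then show False using pq by simp
  qed
  then obtain a where a: "a \<in> set ps" "p \<le> a" "a \<le> q" by blast
  have "X ! p \<le> X ! a" "X ! a \<le> X ! q"
    using sep a pq by (meson leD leI le_less_trans less_le_trans ps)+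
  moreover have "X ! p \<noteq> X ! q" using X pq by (simp add: nth_eq_iff_index_eq)
  ultimately show ?thesis by simp
qed

section \<open>Ranks\<close>

lemma card_less_sorted_nth:
  assumes "finite S" "i < card S"
  shows "card {z \<in> S. z < sorted_list_of_set S ! i} = i"
proof -
  let ?xs = "sorted_list_of_set S"
  have len: "length ?xs = card S" by simp
  have sorted: "sorted_wrt (<) ?xs" by (rule strict_sorted_list_of_set)
  have nth_less: "?xs ! a < ?xs ! b \<longleftrightarrow> a < b" if "a < card S" "b < card S" for a b
    using sorted_wrt_nth_less[OF sorted] that len by (metis linorder_neqE_nat order.asym)
  have "{z \<in> S. z < ?xs ! i} = (!) ?xs ` {..<i}"
  proof (intro equalityI subsetI)
    fix z assume "z \<in> {z \<in> S. z < ?xs ! i}"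
    then obtain a where "a < card S" "z = ?xs ! a" "z < ?xs ! i"
      using assms(1) len by (metis (mono_tags) in_set_conv_nth mem_Collect_eq set_sorted_list_of_set)
    then show "z \<in> (!) ?xs ` {..<i}" using nth_less assms(2) by auto
  next
    fix z assume "z \<in> (!) ?xs ` {..<i}"
    then obtain a where a: "a < i" "z = ?xs ! a" by auto
    then have "z \<in> set ?xs" using assms(2) len by auto
    then show "z \<in> {z \<in> S. z < ?xs ! i}" using a assms nth_less[of a i] by simp
  qed
  moreover have "inj_on ((!) ?xs) {..<i}"
    using assms by (auto simp: inj_on_def nth_eq_iff_index_eq)
  ultimately show ?thesis by (simp add: card_image)
qed

text \<open>An element of a finite set is determined by the number of elements below it; this is why
  the invariants can work with counts alone.\<close>

lemma elem_of_rank_unique: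
  assumes "finite S" "y \<in> S"
  shows "elem_of_rank (Suc (card {z \<in> S. z < y})) S = y" "Suc (card {z \<in> S. z < y}) \<le> card S"
proof -
  obtain i where i: "i < card S" "y = sorted_list_of_set S ! i"
    using assms by (metis in_set_conv_nth length_sorted_list_of_set set_sorted_list_of_set)
  then show "elem_of_rank (Suc (card {z \<in> S. z < y})) S = y" "Suc (card {z \<in> S. z < y}) \<le> card S"
    using card_less_sorted_nth[OF assms(1) i(1)] by (auto simp: elem_of_rank_def)
qed

definition wset :: "'a list list \<Rightarrow> (nat \<Rightarrow> nat) \<Rightarrow> (nat \<Rightarrow> nat) \<Rightarrow> 'a set" where
  "wset A lo hi = (\<Union>i<length A. {A ! i ! q |q. lo i \<le> q \<and> q < hi i})"

lemma finite_wset: "finite (wset A lo hi)"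
proof -
  have "wset A lo hi = (\<lambda>(i, q). A ! i ! q) ` (SIGMA i:{..<length A}. {lo i..<hi i})"
    by (auto simp: wset_def image_iff) force+
  then show ?thesis by simp
qed

text \<open>\<open>wrank\<close> counts positions, ranks in a set count elements. Distinctness
  across all arrays makes the map from positions to elements injective, so both agree.\<close>

lemma card_wset_less:
  assumes dist: "distinct (concat A)"
    and hi: "\<And>i. i < length A \<Longrightarrow> hi i \<le> length (A ! i)"
  shows "card {z \<in> wset A lo hi. z < y} = wrank A lo hi y"
proof -
  let ?D = "SIGMA i:{..<length A}. {q. lo i \<le> q \<and> q < hi i \<and> A ! i ! q < y}"
  have "{z \<in> wset A lo hi. z < y} = (\<lambda>(i, q). A ! i ! q) ` ?D"
    by (auto simp: wset_def image_iff)
  moreover have "inj_on (\<lambda>(i, q). A ! i ! q) ?D"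
  proof (rule inj_onI, clarsimp)
    fix i q j r
    assume "i < length A" "q < hi i" "j < length A" "r < hi j" "A ! i ! q = A ! j ! r"
    then show "i = j \<and> q = r"
      using distinct_concat_nth[OF dist, of i j q r] hi[of i] hi[of j] by simp
  qed
  ultimately have "card {z \<in> wset A lo hi. z < y} = card ?D" by (simp add: card_image)
  also have "\<dots> = wrank A lo hi y"
    unfolding wrank_def wrk_def by (rule card_SigmaI) auto
  finally show ?thesis .
qed

lemma length_subinterval: "hi \<le> length X \<Longrightarrow> length (subinterval lo hi X) = hi - lo"
  unfolding subinterval_def length_take length_drop by linarith

lemma set_subinterval:
  "hi \<le> length X \<Longrightarrow> set (subinterval lo hi X) = {X ! q |q. lo \<le> q \<and> q < hi}"
proof (intro equalityI subsetI)
  fix z assume hi: "hi \<le> length X" and "z \<in> set (subinterval lo hi X)"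
  then obtain j where "j < hi - lo" "z = X ! (lo + j)"
    by (auto simp: subinterval_def in_set_conv_nth)
  then show "z \<in> {X ! q |q. lo \<le> q \<and> q < hi}" by (auto intro!: exI[of _ "lo + j"])
next
  fix z assume hi: "hi \<le> length X" and "z \<in> {X ! q |q. lo \<le> q \<and> q < hi}"
  then obtain q where "lo \<le> q" "q < hi" "z = X ! q" by auto
  then show "z \<in> set (subinterval lo hi X)"
    using hi by (auto simp: subinterval_def in_set_conv_nth intro!: exI[of _ "q - lo"])
qed

text \<open>For \<open>n \<le> 2 * l\<close> the logarithm is at most 1 and may even be negative,
  though reading the lengths alone takes time proportional to \<open>l\<close>; \<open>max 1\<close>
  accounts for this.\<close>

theorem theorem3p6:
  "\<exists>(prog :: program) (d :: nat) (C1 :: real) (C2 :: real).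
     \<forall>(A :: 'a::linorder list list) (u :: nat) (k :: nat) (w :: nat) (l :: nat) (n :: nat).
       l = length A \<longrightarrow> n = sum_list (map length A) \<longrightarrow>
       distinct (concat A) \<longrightarrow>
       (\<forall>X\<in>set A. u_sorted u X) \<longrightarrow>
       1 \<le> u \<longrightarrow> u \<le> n \<longrightarrow> 1 \<le> k \<longrightarrow> k \<le> n \<longrightarrow>
       (n + l) ^ d \<le> 2 ^ w \<longrightarrow>
       (\<exists>(t :: nat) (lo :: nat \<Rightarrow> nat) (hi :: nat \<Rightarrow> nat) (k' :: nat) (B :: 'a list list).
          runs_to prog w A u k t lo hi k' \<and>
          (\<forall>i<l. lo i \<le> hi i \<and> hi i \<le> length (A ! i)) \<and>
          B = map (\<lambda>i. subinterval (lo i) (hi i) (A ! i)) [0..<l] \<and>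
          1 \<le> k' \<and> k' \<le> card (\<Union>X\<in>set B. set X) \<and>
          elem_of_rank k' (\<Union>X\<in>set B. set X) = elem_of_rank k (\<Union>X\<in>set A. set X) \<and>
          real t \<le> C1 * (real l * max 1 (log 2 (real n / real l))) \<and>
          real (sum_list (map length B)) \<le> C2 * (real l * real n / real u))"
proof (rule exI[of _ "(procs, main_com)"], rule exI[of _ 16], rule exI[of _ 1320320],
    rule exI[of _ 128], intro allI impI, goal_cases)
  case (1 A u k w l n)
  note l = 1(1) and n = 1(2) and dist = 1(3) and us = 1(4) and u = 1(5,6) and k = 1(7,8)
  have n1: "1 \<le> n" using k by simp
  have l1: "1 \<le> l" using n1 unfolding l n by (cases A) auto
  \<comment> \<open>As \<open>8192 = 2 ^ 13\<close> and \<open>n + l \<ge> 2\<close>, the exponent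
    16 is 13 plus the cube in \<open>machine\<close>.\<close>
  have "8192 * (n + l) ^ 3 \<le> (n + l) ^ 13 * (n + l) ^ 3"
    using power_mono[of 2 "n + l" 13] n1 l1 by (intro mult_le_mono1) simp
  also have "\<dots> \<le> 2 ^ w" using 1(9) by (simp flip: power_add)
  finally have mach: "machine A w" using n1 by unfold_locales (simp_all add: l n)
  interpret machine A w by (rule mach)
  define hi0 where "hi0 = (\<lambda>i. if i < length A then length (A ! i) else 0)"
  define S where "S = (\<Union>X\<in>set A. set X)"
  define y where "y = elem_of_rank k S"
  have S: "S = wset A (\<lambda>_. 0) hi0"
  proof (intro equalityI subsetI)
    fix z assume "z \<in> S"
    then obtain i q where "i < length A" "q < length (A ! i)" "z = A ! i ! q"
      unfolding S_def by (metis UN_E in_set_conv_nth)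
    then show "z \<in> wset A (\<lambda>_. 0) hi0" by (auto simp: wset_def hi0_def)
  next
    fix z assume "z \<in> wset A (\<lambda>_. 0) hi0"
    then obtain i q where "i < length A" "q < length (A ! i)" "z = A ! i ! q"
      by (auto simp: wset_def hi0_def)
    then have "A ! i \<in> set A" "z \<in> set (A ! i)" by simp_all
    then show "z \<in> S" unfolding S_def by blast
  qed
  have fin: "finite S" by (simp add: S_def)
  have card: "card S = n" using distinct_card[OF dist] by (simp add: S_def n length_concat)
  have "y = sorted_list_of_set S ! (k - 1)" by (simp add: y_def elem_of_rank_def)
  then have rank: "card {z \<in> S. z < y} = k - 1" and yS: "y \<in> S"
    using card_less_sorted_nth[OF fin, of "k - 1"] k card
      nth_mem[of "k - 1" "sorted_list_of_set S"] fin by auto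
  have "wrank A (\<lambda>_. 0) hi0 y = k - 1"
    using card_wset_less[OF dist, of hi0 "\<lambda>_. 0" y] rank unfolding S by (simp add: hi0_def)
  moreover have "\<exists>i<length A. \<exists>q<length (A ! i). A ! i ! q = y"
    using yS unfolding S wset_def hi0_def by fastforce
  ultimately have target: "target A (\<lambda>_. 0) hi0 y k"
    using k unfolding target_def by (auto simp: hi0_def)
  have spaced: "A ! i ! p < A ! i ! q"
    if "i < length A" "p + Suc (n div u) \<le> q" "q < length (A ! i)" for i p q
    using u_sorted_spaced[OF _ u(1) _ that(2,3)] us that(1) length_nth_le[OF that(1)] n by simp
  obtain t v m where run: "exec w A procs main_com ((\<lambda>_. 0)(0 := length A, 1 := u, 2 := k)) (\<lambda>_ _. 0) t v m"
    and t: "t \<le> 110010 * l * iters l n + 200 * l"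
    and wins: "wins A (m 0) (m 1)" and tgt: "target A (m 0) (m 1) y (v 0)"
    and mass: "wmass A (m 0) (m 1) \<le> 64 * l * Suc (n div u)"
    using main_spec[OF dist spaced[unfolded n] target[unfolded hi0_def]]
    unfolding wp_def l n by blast
  define B where "B = map (\<lambda>i. subinterval (m 0 i) (m 1 i) (A ! i)) [0..<l]"
  have win: "m 0 i \<le> m 1 i" "m 1 i \<le> length (A ! i)" if "i < length A" for i
    using wins that by (auto simp: wins_def)
  have U: "(\<Union>X\<in>set B. set X) = wset A (m 0) (m 1)"
    using win(2) unfolding B_def l wset_def by (simp add: set_subinterval lessThan_atLeast0)
  have yU: "y \<in> wset A (m 0) (m 1)"
  proof -
    obtain i q where "i < length A" "q < length (A ! i)" "A ! i ! q = y"
      using tgt by (auto simp: target_def)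
    moreover from this have "\<not> q < m 0 i" "\<not> m 1 i \<le> q" using tgt by (auto simp: target_def)
    ultimately show ?thesis unfolding wset_def by (intro UN_I[of i]) auto
  qed
  have k': "v 0 = Suc (card {z \<in> wset A (m 0) (m 1). z < y})"
    using tgt card_wset_less[OF dist win(2)] by (simp add: target_def)
  have "sum_list (map length B) = wmass A (m 0) (m 1)"
  proof -
    have "map length B = map (\<lambda>i. m 1 i - m 0 i) [0..<length A]"
      using win(2) by (simp add: B_def l length_subinterval)
    then show ?thesis by (simp add: wmass_def interv_sum_list_conv_sum_set_nat lessThan_atLeast0)
  qed
  then have "real (sum_list (map length B)) \<le> real (64 * l * Suc (n div u))"
    using mass by (simp only: of_nat_le_iff)
  \<comment> \<open>By \<open>u \<le> n\<close> the summand 1 is at most \<open>n / u\<close>, which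
    doubles 64 to 128.\<close>
  also have "\<dots> \<le> 64 * real l * (2 * (real n / real u))"
  proof -
    have "real (n div u) \<le> real n / real u" by (rule of_nat_div_le_of_nat)
    moreover have "1 \<le> real n / real u" using u by simp
    ultimately have "real (Suc (n div u)) \<le> 2 * (real n / real u)" by simp
    then have "64 * real l * real (Suc (n div u)) \<le> 64 * real l * (2 * (real n / real u))"
      by (rule mult_left_mono) simp
    then show ?thesis by (simp only: of_nat_mult of_nat_numeral)
  qed
  finally have size: "real (sum_list (map length B)) \<le> 128 * (real l * real n / real u)"
    by simp
  define M where "M = max 1 (log 2 (real n / real l))"
  have "real t \<le> real (110010 * l * iters l n + 200 * l)"
    using t by (simp only: of_nat_le_iff)
  also have "\<dots> = 110010 * real l * real (iters l n) + 200 * real l * 1" by simp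
  \<comment> \<open>\<open>M \<ge> 1\<close> absorbs the start-up cost, and
    \<open>12 * 110010 + 200 = 1320320\<close>.\<close>
  also have "\<dots> \<le> 110010 * real l * (12 * M) + 200 * real l * M"
    using iters_bound[OF l1, of n, folded M_def]
    by (intro add_mono mult_left_mono) (auto simp: M_def)
  also have "\<dots> = 1320320 * (real l * M)" by (simp add: algebra_simps)
  finally have time: "real t \<le> 1320320 * (real l * M)" .
  show ?case
    using run win size time[unfolded M_def] elem_of_rank_unique[OF finite_wset yU] k' U
    by (intro exI[of _ t] exI[of _ "m 0"] exI[of _ "m 1"] exI[of _ "v 0"] exI[of _ B])
      (auto simp: runs_to_def B_def l y_def S_def)
qed

end
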